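(* Let $s\ge 1$ and $i$ be positive integers with $i>s+3/2$. The Jones polynomial of the pretzel knot $P(-(2s+1),\,2s+1,\,2i+1)$ is \[ 1+t^{-2i-1}\bigg[t^{2s+1}+t^{-(2s+1)}-(t+t^{-1})-2s+\sum_{j=1}^{2s}(-1)^{j+1}(2s+1-j)\,(t^{j}+t^{-j})\bigg]. \]
   Context: Knots are in $S^3$. For odd integers $p,q,r$, the pretzel knot $P(p,q,r)$ is the boundary of the surface formed by two disjoint disks, one above the other, joined by three vertical bands placed side by side, having respectively $|p|,|q|,|r|$ half-twists; the handedness of the half-twists in each band is determined by the sign of the corresponding integer (the same handedness for all positive entries, the opposite one for all negative entries). Each band thus gives a column of $|p|$, $|q|$, $|r|$ crossings. Since $p,q,r$ are odd, this surface is orientable and its boundary is a knot; the knot is oriented as the boundary of this surface (so the two strands of each column run antiparallel), and the sign convention is that crossings in a column with a positive entry are negative crossings and crossings in a column with a negative entry are positive crossings. The Jones polynomial $V$ is the invariant of oriented links, with values in $\mathbb{Z}[t^{1/2},t^{-1/2}]$, determined by $V(\text{unknot})=1$ and the skein relation $t^{-1}V(L_+)-tV(L_-)+(t^{-1/2}-t^{1/2})V(L_0)=0$, where $L_+,L_-,L_0$ are oriented diagrams identical except near one crossing, where they have respectively a positive crossing, a negative crossing, and the oriented smoothing. *)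

theory Defs
  imports Complex_Main "HOL-Library.Poly_Mapping"
begin

section \<open>Oriented link diagrams\<close>

text \<open>
  An oriented link diagram is given in Morse position and read from top to bottom: each entry of
  the list contains exactly one local maximum, local minimum or crossing, and the number attached
  to it is the number of strands passing to its left. All other strands run vertically.
  The strands at a given height are listed from left to right by their
  orientations, \<open>True\<close> meaning downwards.

  \<open>Cap d\<close> creates two adjacent strands, of orientations \<open>d\<close> (left) and \<open>\<not> d\<close> (right).
  \<open>Cup\<close> joins two adjacent strands of opposite orientations.
  \<open>Cross c\<close> crosses two adjacent strands; the strand running from the upper left to the lower right
  is the overstrand iff \<open>c\<close> holds.
\<close>

datatype shape = Cap bool | Cup | Cross bool

type_synonym diagram = "(shape \<times> nat) list"

fun slice :: "shape \<times> nat \<Rightarrow> bool list \<Rightarrow> bool list option" where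
  "slice (Cap d, i) xs =
     (if i \<le> length xs then Some (take i xs @ [d, \<not> d] @ drop i xs) else None)"
| "slice (Cup, i) xs =
     (if i + 1 < length xs \<and> xs ! i \<noteq> xs ! (i + 1)
      then Some (take i xs @ drop (i + 2) xs) else None)"
| "slice (Cross c, i) xs =
     (if i + 1 < length xs then Some (xs[i := xs ! (i + 1), i + 1 := xs ! i]) else None)"

fun strands :: "diagram \<Rightarrow> bool list \<Rightarrow> bool list option" where
  "strands [] xs = Some xs"
| "strands (e # D) xs = Option.bind (slice e xs) (strands D)"

definition link_diagram :: "diagram \<Rightarrow> bool" where
  "link_diagram D \<longleftrightarrow> D \<noteq> [] \<and> strands D [] = Some []"


section \<open>Isotopy of oriented links\<close>

fun ins :: "shape \<Rightarrow> nat" where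
  "ins (Cap d) = 0"
| "ins Cup = 2"
| "ins (Cross c) = 2"

fun outs :: "shape \<Rightarrow> nat" where
  "outs (Cap d) = 2"
| "outs Cup = 0"
| "outs (Cross c) = 2"

text \<open>
  The moves generating isotopy of links for diagrams in Morse position. The first five generate
  planar isotopy (exchanging the heights of distant pieces, cancelling a maximum against a
  minimum, and moving a strand across a maximum or minimum past the extremum); the others are the
  three Reidemeister moves, the first one being stated for kinks placed at an extremum.
  In \<open>R3\<close>, of the strands 1, 2, 3 counted from the left at the top, 1 is above 2 iff \<open>a\<close>, 1 is above
  3 iff \<open>b\<close>, and 2 is above 3 iff \<open>c\<close>; the side condition excludes the two cyclic cases.
\<close>

inductive move :: "diagram \<Rightarrow> diagram \<Rightarrow> bool" where
  exchange: "move [(e, i), (f, i + outs e + k)] [(f, i + ins e + k), (e, i)]"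
| zigzag_right: "move [(Cap d, i + 1), (Cup, i)] []"
| zigzag_left: "move [(Cap d, i), (Cup, i + 1)] []"
| slide_Cap: "move [(Cap d, i), (Cross c, i + 1)] [(Cap d, i + 1), (Cross (\<not> c), i)]"
| slide_Cup: "move [(Cross c, i), (Cup, i + 1)] [(Cross (\<not> c), i + 1), (Cup, i)]"
| R1_Cap: "move [(Cap d, i), (Cross c, i)] [(Cap (\<not> d), i)]"
| R1_Cup: "move [(Cross c, i), (Cup, i)] [(Cup, i)]"
| R2: "move [(Cross c, i), (Cross (\<not> c), i)] []"
| R3: "(a = c \<longrightarrow> b = a) \<Longrightarrow>
    move [(Cross a, i), (Cross b, i + 1), (Cross c, i)]
         [(Cross c, i + 1), (Cross b, i), (Cross a, i + 1)]"

definition diagram_step :: "diagram \<Rightarrow> diagram \<Rightarrow> bool" where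
  "diagram_step D D' \<longleftrightarrow> link_diagram D \<and> link_diagram D' \<and>
     (\<exists>A B l r. move l r \<and> D = A @ l @ B \<and> D' = A @ r @ B)"

definition isotopic :: "diagram \<Rightarrow> diagram \<Rightarrow> bool" where
  "isotopic = equivclp diagram_step"


section \<open>The Jones polynomial\<close>

text \<open>
  The ring \<open>\<int>[t\<^sup>1\<^sup>/\<^sup>2, t\<^sup>-\<^sup>1\<^sup>/\<^sup>2]\<close> as the group ring of \<open>\<int>\<close>: the basis element of exponent \<open>n\<close> is
  the \<open>n\<close>-th power of the square root of \<open>t\<close>.
\<close>

type_synonym laurent = "int \<Rightarrow>\<^sub>0 int"

definition thalf :: "int \<Rightarrow> laurent" where
  "thalf n = Poly_Mapping.single n 1"

definition tpow :: "int \<Rightarrow> laurent" where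
  "tpow k = thalf (2 * k)"

text \<open>
  Rotating the overstrand counterclockwise onto the understrand (as oriented lines) through an
  angle less than \<open>\<pi>\<close> is what makes a crossing positive. If both strands point downwards, this
  happens when the strand from the upper right to the lower left is above; reversing one of the
  strands changes the sign.
\<close>

definition positive_crossing :: "bool list \<Rightarrow> nat \<Rightarrow> bool \<Rightarrow> bool" where
  "positive_crossing xs i c \<longleftrightarrow> (c \<longleftrightarrow> xs ! i \<noteq> xs ! (i + 1))"

text \<open>The oriented smoothing of a crossing of the strands \<open>i\<close> and \<open>i + 1\<close>.\<close>

definition smoothing :: "bool list \<Rightarrow> nat \<Rightarrow> diagram" where
  "smoothing xs i = (if xs ! i = xs ! (i + 1) then [] else [(Cup, i), (Cap (xs ! (i + 1)), i)])"

definition skein_triple :: "diagram \<Rightarrow> diagram \<Rightarrow> diagram \<Rightarrow> bool" where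
  "skein_triple Dp Dn D0 \<longleftrightarrow> link_diagram Dp \<and> link_diagram Dn \<and> link_diagram D0 \<and>
     (\<exists>A B i c xs. strands A [] = Some xs \<and> positive_crossing xs i c \<and>
        Dp = A @ [(Cross c, i)] @ B \<and>
        Dn = A @ [(Cross (\<not> c), i)] @ B \<and>
        D0 = A @ smoothing xs i @ B)"

definition unknot :: diagram where
  "unknot = [(Cap True, 0), (Cup, 0)]"

definition is_jones :: "(diagram \<Rightarrow> laurent) \<Rightarrow> bool" where
  "is_jones V \<longleftrightarrow>
     (\<forall>D D'. isotopic D D' \<longrightarrow> V D = V D') \<and>
     V unknot = 1 \<and>
     (\<forall>Dp Dn D0. skein_triple Dp Dn D0 \<longrightarrow>
        tpow (- 1) * V Dp - tpow 1 * V Dn + (thalf (- 1) - thalf 1) * V D0 = 0)"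

text \<open>\<^const>\<open>is_jones\<close> determines the values on all link diagrams; the choice concerns
  only lists that are not link diagrams.\<close>

definition jones :: "diagram \<Rightarrow> laurent" where
  "jones = (SOME V. is_jones V)"


section \<open>Pretzel knots\<close>

text \<open>
  For odd arguments, the strands are oriented alternately throughout, so those of each column
  are antiparallel, as for the boundary of the surface consisting of the disk between the maxima,
  the disk between the minima, and the bands given by the columns. Hence \<open>Cross False\<close>
  is a negative crossing here and \<open>Cross True\<close> a positive one.
\<close>

definition column :: "int \<Rightarrow> nat \<Rightarrow> diagram" where
  "column p i = replicate (nat \<bar>p\<bar>) (Cross (p < 0), i)"

definition pretzel :: "int \<Rightarrow> int \<Rightarrow> int \<Rightarrow> diagram" where
  "pretzel p q r =
     [(Cap True, 0), (Cap False, 1), (Cap False, 3)]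
     @ column p 0 @ column q 2 @ column r 4
     @ [(Cup, 1), (Cup, 1), (Cup, 0)]"

end

(*
  The Jones polynomial exists: the Kauffman bracket, realized as a vertex model with two spins and
  normalized by a unit depending on the orientations, is invariant under the moves and divisible by
  the value z of a circle. Its value on a pretzel knot is then forced by the skein relation.
  Changing a crossing of a column removes two half-twists, while smoothing it turns the other two
  columns into an antiparallel (2,n) torus link, whose own value satisfies such a recursion. After
  multiplication by z these affine recursions have closed solutions, anchored at P(-1,1,r), which
  is the unknot. Multiplying the claimed formula by z^2 telescopes the alternating sum.
*)

theory Submission
  imports Defs
begin

text \<open>\<open>jones\<close> is a choice, so nothing is known about it until some function
  satisfying \<open>is_jones\<close> is exhibited. The state sum itself is no witness: it gives a
  circle the value \<open>- (hf + hi)\<close> instead of 1, and this is not a unit of the Laurent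
  ring, so divisibility of every value has to be proved. It comes from quantum group invariance.
  Afterwards only the three clauses of \<open>is_jones\<close> enter.

  The skein computation is shaped by the order of reduction. The left column is shortened first,
  down to one crossing. Smoothing in the middle column then leaves a simple link, because that
  single crossing is opposite to those of the right column and cancels one of them. Multiplication
  by \<open>hf + hi\<close> turns the skein coefficient \<open>hi - hf\<close> into
  \<open>tpow (- 1) - tpow 1\<close>; each affine recursion thereby acquires a fixed point inside
  the Laurent ring and becomes a pure scaling about it.\<close>

abbreviation hf :: laurent where "hf \<equiv> thalf 1"
abbreviation hi :: laurent where "hi \<equiv> thalf (- 1)"

lemma thalf_mult: "thalf m * thalf n = thalf (m + n)"
  by (simp add: thalf_def mult_single)

lemma thalf_0: "thalf 0 = 1"
  by (simp add: thalf_def)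

lemma hf_hi: "hf * hi = 1"
  by (simp add: thalf_mult thalf_0)

lemma tpow_1_eq: "tpow 1 = hf * hf" "tpow (- 1) = hi * hi"
  by (simp_all add: tpow_def thalf_mult)

lemma loop_value_nonzero: "hf + hi \<noteq> 0"
proof
  assume "hf + hi = 0"
  then have "Poly_Mapping.lookup (hf + hi) 1 = 0" by simp
  then show False by (simp add: thalf_def lookup_add lookup_single)
qed

section \<open>A state sum\<close>

text \<open>Boolean lists play two roles: orientations in diagrams, spins in state sums; the two are
  tied only by their length. The weights are an invariant pairing and copairing of two spin-1/2
  representations, scaled so that both zigzags are exactly the identity. A circle then has the value
  \<open>- hi - hf\<close>.\<close>

definition cup_wt :: "bool list \<Rightarrow> laurent" where
  "cup_wt zs = (if zs = [False, True] then - hi else if zs = [True, False] then 1 else 0)"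

definition cap_wt :: "bool list \<Rightarrow> laurent" where
  "cap_wt ys = (if ys = [False, True] then 1 else if ys = [True, False] then - hf else 0)"

fun entry :: "shape \<Rightarrow> bool list \<Rightarrow> bool list \<Rightarrow> laurent" where
  "entry (Cap d) zs ys = cap_wt ys"
| "entry Cup zs ys = cup_wt zs"
| "entry (Cross c) zs ys = of_bool (zs = ys) + (if c then hi else hf) * cup_wt zs * cap_wt ys"

text \<open>Functions of the lower spins are pulled back to functions of the upper spins, so reading
  a diagram from top to bottom becomes a \<open>foldr\<close>.\<close>

fun act :: "shape \<times> nat \<Rightarrow> (bool list \<Rightarrow> laurent) \<Rightarrow> bool list \<Rightarrow> laurent" where
  "act (e, i) f xs = (\<Sum>ys | length ys = outs e. entry e (take (ins e) (drop i xs)) ys *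
     f (take i xs @ ys @ drop (i + ins e) xs))"

definition state_sum :: "diagram \<Rightarrow> (bool list \<Rightarrow> laurent) \<Rightarrow> bool list \<Rightarrow> laurent" where
  "state_sum D f = foldr act D f"

lemma state_sum_simps [simp]:
  "state_sum [] f = f"
  "state_sum (e # D) f = act e (state_sum D f)"
  "state_sum (A @ B) f = state_sum A (state_sum B f)"
  by (simp_all add: state_sum_def)

text \<open>
  With \<open>e\<close> the composite of a minimum and a maximum, the Kauffman bracket of a crossing is here
  \<open>I + hi e\<close> or \<open>I + hf e\<close>, independently of orientations. This differs from the usual symmetric
  normalization, which needs fourth roots of \<open>t\<close>; the missing factor, together with the writhe
  correction, is the orientation-dependent unit \<open>local_wt\<close>.
\<close>

fun local_slice :: "shape \<Rightarrow> bool list \<Rightarrow> bool list option" where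
  "local_slice (Cap d) zs = Some [d, \<not> d]"
| "local_slice Cup zs = (if zs ! 0 \<noteq> zs ! 1 then Some [] else None)"
| "local_slice (Cross c) zs = Some [zs ! 1, zs ! 0]"

fun local_wt :: "shape \<Rightarrow> bool list \<Rightarrow> laurent" where
  "local_wt (Cross c) zs =
     (if zs ! 0 = zs ! 1 then (if c then - hi else - hf)
      else (if c then - (hf * hf) else - (hi * hi)))"
| "local_wt e zs = 1"

fun wt :: "diagram \<Rightarrow> bool list \<Rightarrow> laurent" where
  "wt [] xs = 1"
| "wt ((e, i) # D) xs =
     local_wt e (take (ins e) (drop i xs)) * wt D (the (slice (e, i) xs))"

text \<open>Index arithmetic is traded for a splitting \<open>P @ zs @ R\<close>, which makes
  visible that a piece affects only the block \<open>zs\<close>. The later evaluations of slices,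
  weights and sums go through such splittings.\<close>

lemma slice_append:
  assumes "length P = i" "length zs = ins e"
  shows "slice (e, i) (P @ zs @ R) = map_option (\<lambda>ys. P @ ys @ R) (local_slice e zs)"
proof (cases e)
  case (Cross c)
  then obtain a b where "zs = [a, b]"
    using assms by (auto simp: length_Suc_conv numeral_2_eq_2)
  then show ?thesis using assms Cross by (auto simp: nth_append list_update_append)
next
  case Cup
  then obtain a b where "zs = [a, b]"
    using assms by (auto simp: length_Suc_conv numeral_2_eq_2)
  then show ?thesis using assms Cup by (auto simp: nth_append)
qed (use assms in auto)

lemma slice_SomeE:
  assumes "slice (e, i) xs = Some ys"
  obtains P zs R us where "xs = P @ zs @ R" "length P = i" "length zs = ins e"
    "local_slice e zs = Some us" "ys = P @ us @ R"
proof -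
  have *: "i + ins e \<le> length xs"
    using assms by (cases e) (auto split: if_splits)
  let ?P = "take i xs" and ?z = "take (ins e) (drop i xs)" and ?R = "drop (i + ins e) xs"
  have 1: "xs = ?P @ ?z @ ?R" "length ?P = i" "length ?z = ins e"
    using * by (simp_all add: add.commute[of i] flip: drop_drop)
  have "map_option (\<lambda>ys. ?P @ ys @ ?R) (local_slice e ?z) = Some ys"
    using assms slice_append[OF 1(2,3)] 1(1) by metis
  then show ?thesis using that[OF 1] by auto
qed

lemma local_slice_length: "local_slice e zs = Some us \<Longrightarrow> length us = outs e"
  by (cases e) (auto split: if_splits)

lemma act_append:
  assumes "length P = i" "length zs = ins e"
  shows "act (e, i) f (P @ zs @ R) =
    (\<Sum>ys | length ys = outs e. entry e zs ys * f (P @ ys @ R))"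
  using assms by simp

lemma wt_append:
  assumes "length P = i" "length zs = ins e" "local_slice e zs = Some us"
  shows "wt ((e, i) # D) (P @ zs @ R) = local_wt e zs * wt D (P @ us @ R)"
  using slice_append[OF assms(1,2)] assms by (simp del: slice.simps)

declare act.simps [simp del] slice.simps [simp del] wt.simps(2) [simp del]

lemma sum_lists_2:
  fixes g :: "bool list \<Rightarrow> laurent"
  shows "(\<Sum>ys | length ys = 2. g ys) =
    g [False, False] + g [False, True] + g [True, False] + g [True, True]"
proof -
  have *: "{ys. length ys = 2} = {[False, False], [False, True], [True, False], [True, True]}"
    by (auto simp: length_Suc_conv numeral_2_eq_2)
  show ?thesis unfolding * by (simp add: add.assoc)
qed

lemma act_at:
  assumes "length P = i"
  shows "act (Cap d, i) f (P @ R) = f (P @ False # True # R) - hf * f (P @ True # False # R)"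
    and "act (Cup, i) f (P @ a # b # R) = cup_wt [a, b] * f (P @ R)"
    and "act (Cross c, i) f (P @ a # b # R) = f (P @ a # b # R) +
      (if c then hi else hf) * cup_wt [a, b] *
      (f (P @ False # True # R) - hf * f (P @ True # False # R))"
  using act_append[OF assms, of "[]" "Cap d"] act_append[OF assms, of "[a, b]" Cup]
    act_append[OF assms, of "[a, b]" "Cross c"]
  by (cases a; cases b; simp add: sum_lists_2 cap_wt_def cup_wt_def algebra_simps)+

text \<open>The local moves act at both \<open>i\<close> and \<open>i + 1\<close>. Keeping the
  skipped strand as a cons cell lets both positions be evaluated on one splitting.\<close>

lemma act_at_Suc:
  assumes "length P = i"
  shows "act (Cap d, Suc i) f (P @ x # R) =
      f (P @ x # False # True # R) - hf * f (P @ x # True # False # R)"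
    and "act (Cup, Suc i) f (P @ x # a # b # R) = cup_wt [a, b] * f (P @ x # R)"
    and "act (Cross c, Suc i) f (P @ x # a # b # R) = f (P @ x # a # b # R) +
      (if c then hi else hf) * cup_wt [a, b] *
      (f (P @ x # False # True # R) - hf * f (P @ x # True # False # R))"
  using act_at[of "P @ [x]" "Suc i"] assms by simp_all

lemma slice_at:
  assumes "length P = i"
  shows "slice (Cap d, i) (P @ R) = Some (P @ d # (\<not> d) # R)"
    and "slice (Cup, i) (P @ a # b # R) = (if a \<noteq> b then Some (P @ R) else None)"
    and "slice (Cross c, i) (P @ a # b # R) = Some (P @ b # a # R)"
  using slice_append[OF assms, of "[]" "Cap d"] slice_append[OF assms, of "[a, b]" Cup]
    slice_append[OF assms, of "[a, b]" "Cross c"] by simp_all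

lemma slice_at_Suc:
  assumes "length P = i"
  shows "slice (Cap d, Suc i) (P @ x # R) = Some (P @ x # d # (\<not> d) # R)"
    and "slice (Cup, Suc i) (P @ x # a # b # R) = (if a \<noteq> b then Some (P @ x # R) else None)"
    and "slice (Cross c, Suc i) (P @ x # a # b # R) = Some (P @ x # b # a # R)"
  using slice_at[of "P @ [x]" "Suc i"] assms by simp_all

lemma wt_Cap_Cup:
  "wt ((Cap d, i) # D) xs = wt D (the (slice (Cap d, i) xs))"
  "wt ((Cup, i) # D) xs = wt D (the (slice (Cup, i) xs))"
  by (simp_all add: wt.simps(2))

lemma wt_Cross:
  assumes "length P = i"
  shows "wt ((Cross c, i) # D) (P @ a # b # R) = local_wt (Cross c) [a, b] * wt D (P @ b # a # R)"
    and "wt ((Cross c, Suc i) # D) (P @ x # a # b # R) =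
      local_wt (Cross c) [a, b] * wt D (P @ x # b # a # R)"
  using wt_append[of P i "[a, b]" "Cross c" "[b, a]" D R]
    wt_append[of "P @ [x]" "Suc i" "[a, b]" "Cross c" "[b, a]" D R] assms
  by (simp_all del: local_wt.simps)

section \<open>Invariance of weight times state sum under the moves\<close>

lemma exchange_invariant:
  assumes "slice (e, i) os = Some os1" "slice (f, i + outs e + k) os1 = Some os2"
    "length xs = length os"
  shows "\<exists>os3. slice (f, i + ins e + k) os = Some os3 \<and> slice (e, i) os3 = Some os2 \<and>
    wt [(e, i), (f, i + outs e + k)] os = wt [(f, i + ins e + k), (e, i)] os \<and>
    act (e, i) (act (f, i + outs e + k) g) xs = act (f, i + ins e + k) (act (e, i) g) xs"
proof -
  obtain P zs R us where 1: "os = P @ zs @ R" "length P = i" "length zs = ins e"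
    "local_slice e zs = Some us" "os1 = P @ us @ R"
    using assms(1) by (rule slice_SomeE)
  have lus: "length us = outs e" using 1(4) local_slice_length by blast
  obtain P' zs' R' us' where 2: "os1 = P' @ zs' @ R'" "length P' = i + outs e + k"
    "length zs' = ins f" "local_slice f zs' = Some us'" "os2 = P' @ us' @ R'"
    using assms(2) by (rule slice_SomeE)
  define Q where "Q = drop (i + outs e) P'"
  have lQ: "length Q = k" using 2(2) by (simp add: Q_def)
  have tk: "take (i + outs e) os1 = P @ us" using 1 lus by simp
  have "take (i + outs e) os1 = take (i + outs e) P'" using 2 by simp
  then have P': "P' = P @ us @ Q"
    using tk append_take_drop_id[of "i + outs e" P'] unfolding Q_def by (metis append_assoc)
  have R: "R = Q @ zs' @ R'" using 1(5) 2(1) P' by simp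
  have os: "os = P @ zs @ Q @ zs' @ R'" using 1 R by simp
  have A: "slice (f, i + ins e + k) os = Some (P @ zs @ Q @ us' @ R')"
    using slice_append[of "P @ zs @ Q" "i + ins e + k" zs' f R'] 1 2 lQ by (simp add: os)
  have B: "slice (e, i) (P @ zs @ Q @ us' @ R') = Some os2"
    using slice_append[of P i zs e "Q @ us' @ R'"] 1 2 P' by simp
  have C: "wt [(e, i), (f, i + outs e + k)] os = local_wt e zs * local_wt f zs'"
    using wt_append[of P i zs e us _ "Q @ zs' @ R'"] 1 os
      wt_append[of "P @ us @ Q" "i + outs e + k" zs' f us' "[]" R'] 2 lQ lus
    by simp
  have C': "wt [(f, i + ins e + k), (e, i)] os = local_wt e zs * local_wt f zs'"
    using wt_append[of P i zs e us "[]" "Q @ us' @ R'"] 1 os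
      wt_append[of "P @ zs @ Q" "i + ins e + k" zs' f us' _ R'] 2 lQ lus
    by (simp add: mult.commute)
  \<comment> \<open>The spins are cut at the same positions as the orientations; the two lists share
    only their length, so the blocks have to be recovered by \<open>take\<close> and
    \<open>drop\<close>.\<close>
  define p a m b r where "p = take i xs" and "a = take (ins e) (drop i xs)"
    and "m = take k (drop (i + ins e) xs)" and "b = take (ins f) (drop (i + ins e + k) xs)"
    and "r = drop (i + ins e + k + ins f) xs"
  have lxs: "length xs = i + ins e + k + ins f + length R'"
    using assms(3) os 1 2 lQ by simp
  have l: "length p = i" "length a = ins e" "length m = k" "length b = ins f"
    using lxs by (simp_all add: p_def a_def m_def b_def)
  have xs: "xs = p @ a @ m @ b @ r"
    unfolding p_def a_def m_def b_def r_def
    by (metis (no_types) append_take_drop_id drop_drop add.commute)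
  have "act (e, i) (act (f, i + outs e + k) g) xs =
    (\<Sum>ys | length ys = outs e. entry e a ys * act (f, i + outs e + k) g (p @ ys @ m @ b @ r))"
    using act_append[of p i a e _ "m @ b @ r"] l xs by simp
  also have "\<dots> = (\<Sum>ys | length ys = outs e. entry e a ys *
     (\<Sum>zs | length zs = outs f. entry f b zs * g (p @ ys @ m @ zs @ r)))"
  proof (intro sum.cong refl arg_cong2[where f = "(*)"])
    fix ys :: "bool list" assume "ys \<in> {ys. length ys = outs e}"
    then show "act (f, i + outs e + k) g (p @ ys @ m @ b @ r) =
      (\<Sum>zs | length zs = outs f. entry f b zs * g (p @ ys @ m @ zs @ r))"
      using act_append[of "p @ ys @ m" "i + outs e + k" b f g r] l by simp
  qed
  \<comment> \<open>The two pieces read the disjoint blocks \<open>a\<close> and \<open>b\<close>,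
    so the sums over their new spins can be interchanged.\<close>
  also have "\<dots> = (\<Sum>zs | length zs = outs f. entry f b zs *
     (\<Sum>ys | length ys = outs e. entry e a ys * g (p @ ys @ m @ zs @ r)))"
    by (simp add: sum_distrib_left mult.left_commute) (rule sum.swap)
  also have "\<dots> = (\<Sum>zs | length zs = outs f. entry f b zs * act (e, i) g (p @ a @ m @ zs @ r))"
  proof (intro sum.cong refl arg_cong2[where f = "(*)"])
    fix zs :: "bool list"
    show "(\<Sum>ys | length ys = outs e. entry e a ys * g (p @ ys @ m @ zs @ r)) =
       act (e, i) g (p @ a @ m @ zs @ r)"
      using act_append[of p i a e g "m @ zs @ r"] l by simp
  qed
  also have "\<dots> = act (f, i + ins e + k) (act (e, i) g) xs"
    using act_append[of "p @ a @ m" "i + ins e + k" b f _ r] l xs by simp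
  finally show ?thesis using A B C C' by simp
qed

lemma split_zero:
  assumes "i \<le> length xs"
  obtains P R where "xs = P @ R" "length P = i"
  using assms that[of "take i xs" "drop i xs"] by simp

lemma split_one:
  assumes "i < length xs"
  obtains P a R where "xs = P @ a # R" "length P = i"
  using assms that[of "take i xs" "xs ! i" "drop (Suc i) xs"] by (simp add: id_take_nth_drop)

lemma split_two:
  assumes "i + 1 < length xs"
  obtains P a b R where "xs = P @ a # b # R" "length P = i"
proof -
  have "i < length xs" using assms by simp
  then obtain P a R where 1: "xs = P @ a # R" "length P = i"
    by (rule split_one)
  with assms obtain b R' where "R = b # R'" by (cases R) auto
  with 1 that show ?thesis by simp
qed

lemma split_three:
  assumes "i + 2 < length xs"
  obtains P a b c R where "xs = P @ a # b # c # R" "length P = i"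
proof -
  have "i + 1 < length xs" using assms by simp
  then obtain P a b R where 1: "xs = P @ a # b # R" "length P = i"
    by (rule split_two)
  with assms obtain c R' where "R = c # R'" by (cases R) auto
  with 1 that show ?thesis by simp
qed

lemma slice_bounds:
  assumes "slice (e, i) xs = Some ys"
  shows "i + ins e \<le> length xs \<and> length ys + ins e = length xs + outs e"
  using assms by (elim slice_SomeE) (auto dest!: local_slice_length)

lemma hi_hf: "hi * hf = 1"
  by (simp add: thalf_mult thalf_0)

lemma hf_hi_cancel: "hf * (hi * x) = x" "hi * (hf * x) = x"
  by (simp_all only: mult.assoc[symmetric] hf_hi hi_hf mult_1_left)

text \<open>Apart from \<open>exchange\<close>, a move involves at most three strands, so it is a
  finite check over their spins and orientations; \<open>g\<close> stands for whatever lies below.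
  For kinks and slides only the product is invariant: the weights of the two sides differ by a unit
  that the sums compensate.\<close>

lemma move_invariant:
  assumes "move l r" "strands l os = Some os'" "length xs = length os"
  shows "strands r os = Some os' \<and> wt l os * state_sum l g xs = wt r os * state_sum r g xs"
  using assms
proof (cases rule: move.cases)
  case (exchange e i f k)
  with assms(2) obtain os1 where "slice (e, i) os = Some os1"
    "slice (f, i + outs e + k) os1 = Some os'"
    by (auto simp: bind_eq_Some_conv)
  from exchange_invariant[OF this assms(3), of g] show ?thesis
    unfolding exchange by auto
next
  case (zigzag_right d i)
  with assms(2) have l: "i < length os"
    by (auto simp: bind_eq_Some_conv dest!: slice_bounds)
  obtain P a R where os: "os = P @ a # R" and i: "length P = i"
    using split_one[OF l] by metis
  obtain P' x R' where xs: "xs = P' @ x # R'" and i': "length P' = i"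
    using split_one[of i xs] l assms(3) by metis
  show ?thesis
    using assms(2) unfolding zigzag_right os xs
    by (cases x; auto simp: slice_at[OF i] slice_at_Suc[OF i] wt_Cap_Cup wt_Cross[OF i]
      act_at[OF i'] act_at_Suc[OF i'] cup_wt_def hf_hi hi_hf hf_hi_cancel algebra_simps
      split: if_splits)
next
  case (zigzag_left d i)
  with assms(2) have l: "i < length os"
    by (auto simp: bind_eq_Some_conv dest!: slice_bounds)
  obtain P a R where os: "os = P @ a # R" and i: "length P = i"
    using split_one[OF l] by metis
  obtain P' x R' where xs: "xs = P' @ x # R'" and i': "length P' = i"
    using split_one[of i xs] l assms(3) by metis
  show ?thesis
    using assms(2) unfolding zigzag_left os xs
    by (cases x; auto simp: slice_at[OF i] slice_at_Suc[OF i] wt_Cap_Cup wt_Cross[OF i]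
      act_at[OF i'] act_at_Suc[OF i'] cup_wt_def hf_hi hi_hf hf_hi_cancel algebra_simps
      split: if_splits)
next
  case (slide_Cap d i c)
  with assms(2) have l: "i < length os"
    by (auto simp: bind_eq_Some_conv dest!: slice_bounds)
  obtain P a R where os: "os = P @ a # R" and i: "length P = i"
    using split_one[OF l] by metis
  obtain P' x R' where xs: "xs = P' @ x # R'" and i': "length P' = i"
    using split_one[of i xs] l assms(3) by metis
  show ?thesis
    using assms(2) unfolding slide_Cap os xs
    by (cases x; auto simp: slice_at[OF i] slice_at_Suc[OF i] wt_Cap_Cup wt_Cross[OF i]
      act_at[OF i'] act_at_Suc[OF i'] cup_wt_def hf_hi hi_hf hf_hi_cancel algebra_simps
      split: if_splits)
next
  case (slide_Cup c i)
  with assms(2) have l: "i + 2 < length os"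
    by (auto simp: bind_eq_Some_conv dest!: slice_bounds)
  obtain P a b c' R where os: "os = P @ a # b # c' # R" and i: "length P = i"
    using split_three[OF l] by metis
  obtain P' x y z R' where xs: "xs = P' @ x # y # z # R'" and i': "length P' = i"
    using split_three[of i xs] l assms(3) by metis
  show ?thesis
    using assms(2) unfolding slide_Cup os xs
    by (cases x; cases y; cases z; auto simp: slice_at[OF i] slice_at_Suc[OF i] wt_Cap_Cup wt_Cross[OF i]
      act_at[OF i'] act_at_Suc[OF i'] cup_wt_def hf_hi hi_hf hf_hi_cancel algebra_simps
      split: if_splits)
next
  case (R1_Cap d i c)
  with assms(2) have l: "i \<le> length os"
    by (auto simp: bind_eq_Some_conv dest!: slice_bounds)
  obtain P R where os: "os = P @ R" and i: "length P = i"
    using split_zero[OF l] by metis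
  obtain P' R' where xs: "xs = P' @ R'" and i': "length P' = i"
    using split_zero[of i xs] l assms(3) by metis
  show ?thesis
    using assms(2) unfolding R1_Cap os xs
    by (auto simp: slice_at[OF i] slice_at_Suc[OF i] wt_Cap_Cup wt_Cross[OF i]
      act_at[OF i'] act_at_Suc[OF i'] cup_wt_def hf_hi hi_hf hf_hi_cancel algebra_simps
      split: if_splits)
next
  case (R1_Cup c i)
  with assms(2) have l: "i + 1 < length os"
    by (auto simp: bind_eq_Some_conv dest!: slice_bounds)
  obtain P a b R where os: "os = P @ a # b # R" and i: "length P = i"
    using split_two[OF l] by metis
  obtain P' x y R' where xs: "xs = P' @ x # y # R'" and i': "length P' = i"
    using split_two[of i xs] l assms(3) by metis
  show ?thesis
    using assms(2) unfolding R1_Cup os xs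
    by (cases x; cases y; auto simp: slice_at[OF i] slice_at_Suc[OF i] wt_Cap_Cup wt_Cross[OF i]
      act_at[OF i'] act_at_Suc[OF i'] cup_wt_def hf_hi hi_hf hf_hi_cancel algebra_simps
      split: if_splits)
next
  case (R2 c i)
  with assms(2) have l: "i + 1 < length os"
    by (auto simp: bind_eq_Some_conv dest!: slice_bounds)
  obtain P a b R where os: "os = P @ a # b # R" and i: "length P = i"
    using split_two[OF l] by metis
  obtain P' x y R' where xs: "xs = P' @ x # y # R'" and i': "length P' = i"
    using split_two[of i xs] l assms(3) by metis
  show ?thesis
    using assms(2) unfolding R2 os xs
    by (cases x; cases y; auto simp: slice_at[OF i] slice_at_Suc[OF i] wt_Cap_Cup wt_Cross[OF i]
      act_at[OF i'] act_at_Suc[OF i'] cup_wt_def hf_hi hi_hf hf_hi_cancel algebra_simps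
      split: if_splits)
next
  case (R3 a c b i)
  with assms(2) have l: "i + 2 < length os"
    by (auto simp: bind_eq_Some_conv dest!: slice_bounds)
  obtain P o1 o2 o3 R where os: "os = P @ o1 # o2 # o3 # R" and i: "length P = i"
    using split_three[OF l] by metis
  obtain P' x y z R' where xs: "xs = P' @ x # y # z # R'" and i': "length P' = i"
    using split_three[of i xs] l assms(3) by metis
  \<comment> \<open>On both sides the same pairs of strands meet with the same crossing types; only
    the order of the factors changes.\<close>
  have weights: "wt l os = wt r os"
    unfolding R3 os
    by (simp add: slice_at[OF i] slice_at_Suc[OF i] wt_Cross[OF i] mult.commute mult.left_commute
      del: local_wt.simps)
  \<comment> \<open>\<open>R3(3)\<close> discards the two cyclic choices of \<open>a\<close>,
    \<open>b\<close>, \<open>c\<close>; every other choice is an identity in each of the eight spin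
    states.\<close>
  have sums: "state_sum l g xs = state_sum r g xs"
    using R3(3) unfolding R3(1,2) xs
    by (cases a; cases b; cases c; simp; cases x; cases y; cases z;
      simp add: act_at[OF i'] act_at_Suc[OF i'] cup_wt_def;
      simp add: hf_hi hi_hf hf_hi_cancel algebra_simps)
  show ?thesis
    using assms(2) weights sums unfolding R3(1,2) os
    by (simp add: slice_at[OF i] slice_at_Suc[OF i])
qed

section \<open>State sums of composite diagrams\<close>

lemma strands_append: "strands (A @ B) xs = Option.bind (strands A xs) (strands B)"
proof (induction A arbitrary: xs)
  case (Cons e A)
  then show ?case by (cases "slice e xs") auto
qed simp

lemma wt_diagram_append:
  "strands A os = Some os' \<Longrightarrow> wt (A @ B) os = wt A os * wt B os'"
  by (induction A arbitrary: os) (auto simp: wt.simps(2) bind_eq_Some_conv mult.assoc)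

lemma act_cong:
  assumes "\<And>ys. length ys + ins e = length xs + outs e \<Longrightarrow> f ys = g ys" "i + ins e \<le> length xs"
  shows "act (e, i) f xs = act (e, i) g xs"
  unfolding act.simps using assms by (intro sum.cong refl arg_cong2[where f = "(*)"]) simp_all

text \<open>Identities between pieces hold only where all positions are in range, so functions can
  be compared only on spin lists of the right length.\<close>

lemma state_sum_cong:
  assumes "strands A os = Some os'" "length xs = length os"
    "\<And>ys. length ys = length os' \<Longrightarrow> f ys = g ys"
  shows "state_sum A f xs = state_sum A g xs"
  using assms(1,2)
proof (induction A arbitrary: os xs)
  case Nil
  then show ?case using assms(3) by simp
next
  case (Cons a A)
  obtain e i where a: "a = (e, i)" by force
  obtain os1 where 1: "slice (e, i) os = Some os1" "strands A os1 = Some os'"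
    using Cons.prems(1) a by (auto simp: bind_eq_Some_conv)
  have "i + ins e \<le> length os \<and> length os1 + ins e = length os + outs e"
    using slice_bounds[OF 1(1)] .
  then show ?case
    unfolding a state_sum_simps using Cons.prems(2)
    by (intro act_cong Cons.IH[OF 1(2)]) auto
qed

lemma act_linear: "act e (\<lambda>ys. a * f ys + b * g ys) xs = a * act e f xs + b * act e g xs"
  by (cases e) (simp add: act.simps sum_distrib_left sum.distrib algebra_simps)

lemma state_sum_linear:
  "state_sum A (\<lambda>ys. a * f ys + b * g ys) xs = a * state_sum A f xs + b * state_sum A g xs"
proof (induction A arbitrary: xs)
  case (Cons e A)
  have "state_sum A (\<lambda>ys. a * f ys + b * g ys) =
      (\<lambda>xs. a * state_sum A f xs + b * state_sum A g xs)"
    by (rule ext) (rule Cons.IH)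
  then show ?case by (simp add: act_linear)
qed simp

lemma state_sum_scale: "state_sum A (\<lambda>ys. c * f ys) xs = c * state_sum A f xs"
  using state_sum_linear[of A c f 0 f] by simp

text \<open>The bracket expansion as an identity of operators. It reduces statements about crossings
  to extrema by linearity; the factor \<open>1\<close> fits the shape of the linearity lemmas, and
  \<open>d\<close> is free because spin weights ignore orientations.\<close>

lemma act_Cross_eq:
  assumes "i + 1 < length xs"
  shows "act (Cross c, i) f xs =
    1 * f xs + (if c then hi else hf) * act (Cup, i) (act (Cap d, i) f) xs"
  using assms by (elim split_two) (simp add: act_at)

lemma circle_eval:
  "slice (Cap d, 0) [] = Some [d, \<not> d]"
  "slice (Cup, 0) [d, \<not> d] = Some []"
  "act (Cap d, 0) f [] = f [False, True] - hf * f [True, False]"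
  "act (Cup, 0) f [a, b] = cup_wt [a, b] * f []"
  using slice_at[of "[]" 0] act_at[of "[]" 0] by simp_all

definition closed_state :: "bool list \<Rightarrow> laurent" where
  "closed_state xs = of_bool (xs = [])"

definition state_value :: "diagram \<Rightarrow> laurent" where
  "state_value D = wt D [] * state_sum D closed_state []"

text \<open>The parts above and below contribute the same factors on both sides, because the
  replaced fragments end in the same orientations \<open>os'\<close>.\<close>

lemma state_value_replace:
  assumes "strands A [] = Some os" "strands l os = Some os'" "strands r os = Some os'"
    "\<And>g xs. length xs = length os \<Longrightarrow> wt l os * state_sum l g xs = wt r os * state_sum r g xs"
  shows "state_value (A @ l @ B) = state_value (A @ r @ B)"
proof -
  have *: "state_value (A @ m @ B) =
      wt A [] * wt B os' * state_sum A (\<lambda>ys. wt m os * state_sum m (state_sum B closed_state) ys) []"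
    if "strands m os = Some os'" for m
    using that assms(1)
    by (simp add: state_value_def wt_diagram_append state_sum_scale mult.assoc mult.left_commute)
  show ?thesis
    unfolding *[OF assms(2)] *[OF assms(3)]
    by (rule arg_cong[where f = "(*) _"], rule state_sum_cong[OF assms(1)]) (simp_all add: assms(4))
qed

lemma state_value_step: "diagram_step D D' \<Longrightarrow> state_value D = state_value D'"
  unfolding diagram_step_def link_diagram_def
proof (elim conjE exE)
  fix A B l r
  assume "strands D [] = Some []" and m: "move l r" and D: "D = A @ l @ B" "D' = A @ r @ B"
  then obtain os os' where "strands A [] = Some os" "strands l os = Some os'"
    by (auto simp: strands_append bind_eq_Some_conv)
  then show ?thesis
    unfolding D using move_invariant[OF m] by (intro state_value_replace) auto
qed

lemma state_value_isotopic: "isotopic D D' \<Longrightarrow> state_value D = state_value D'"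
  unfolding isotopic_def equivclp_def
  by (induction rule: rtranclp_induct) (auto simp: symclp_def dest: state_value_step)

text \<open>Both crossings combine the identity with the cup-cap operator. The units in
  \<open>local_wt\<close> make the cup-cap terms cancel for parallel strands and the identity terms
  cancel for antiparallel ones, which leaves exactly the oriented smoothing.\<close>

lemma state_value_skein:
  assumes "skein_triple Dp Dn D0"
  shows "tpow (- 1) * state_value Dp - tpow 1 * state_value Dn + (hi - hf) * state_value D0 = 0"
proof -
  obtain A B i c os where A: "strands A [] = Some os" and pos: "positive_crossing os i c"
    and D: "Dp = A @ [(Cross c, i)] @ B" "Dn = A @ [(Cross (\<not> c), i)] @ B"
      "D0 = A @ smoothing os i @ B" and Dp: "link_diagram Dp"
    using assms unfolding skein_triple_def by blast
  have "i + 1 < length os"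
    using Dp A unfolding link_diagram_def D
    by (auto simp: strands_append bind_eq_Some_conv dest!: slice_bounds)
  then obtain P a b R where os: "os = P @ a # b # R" and i: "length P = i"
    by (rule split_two)
  have smoothing: "smoothing os i = (if a = b then [] else [(Cup, i), (Cap b, i)])"
    using i by (auto simp: smoothing_def os nth_append)
  have c: "c \<longleftrightarrow> a \<noteq> b"
    using pos i by (simp add: positive_crossing_def os nth_append)
  define os' where "os' = P @ b # a # R"
  define g where "g = state_sum B closed_state"
  have *: "state_value (A @ m @ B) =
      wt A [] * wt B os' * (wt m os * state_sum A (state_sum m g) [])"
    if "strands m os = Some os'" for m
    using that A by (simp add: state_value_def wt_diagram_append g_def ac_simps)
  have s: "strands [(Cross x, i)] os = Some os'" "strands (smoothing os i) os = Some os'" for x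
    unfolding os os'_def smoothing[unfolded os] by (auto simp: slice_at[OF i])
  have "tpow (- 1) * (wt [(Cross c, i)] os * state_sum A (state_sum [(Cross c, i)] g) []) -
     tpow 1 * (wt [(Cross (\<not> c), i)] os * state_sum A (state_sum [(Cross (\<not> c), i)] g) []) +
     (hi - hf) * (wt (smoothing os i) os * state_sum A (state_sum (smoothing os i) g) []) = 0"
  proof -
    define h where "h = act (Cup, i) (act (Cap b, i) g)"
    have *: "state_sum A (state_sum [(Cross x, i)] g) [] =
        1 * state_sum A g [] + (if x then hi else hf) * state_sum A h []" for x
      unfolding state_sum_linear[symmetric] h_def
      using os i by (intro state_sum_cong[OF A]) (simp_all add: act_Cross_eq[of _ _ _ _ b])
    show ?thesis
      unfolding * smoothing tpow_1_eq unfolding os c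
      by (auto simp: wt_Cross[OF i] wt_Cap_Cup hf_hi hi_hf hf_hi_cancel algebra_simps simp flip: h_def)
  qed
  then have "wt A [] * wt B os' * (tpow (- 1) * (wt [(Cross c, i)] os * state_sum A (state_sum [(Cross c, i)] g) []) -
     tpow 1 * (wt [(Cross (\<not> c), i)] os * state_sum A (state_sum [(Cross (\<not> c), i)] g) []) +
     (hi - hf) * (wt (smoothing os i) os * state_sum A (state_sum (smoothing os i) g) [])) = 0"
    by simp
  then show ?thesis
    unfolding D *[OF s(1)] *[OF s(2)] by (simp add: algebra_simps)
qed

section \<open>Divisibility by the value of a circle\<close>

text \<open>
  \<open>raise\<close> is the action of the generator \<open>E\<close> of the quantum group of \<open>sl\<^sub>2\<close> on tensor powers
  of its two-dimensional representation. It commutes with all elementary pieces, so the state sum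
  of a diagram with two upper ends is an invariant functional, hence a multiple of \<open>cup_wt\<close>.
\<close>

definition weight :: "bool \<Rightarrow> laurent" where
  "weight x = (if x then hi else hf)"

fun raise :: "(bool list \<Rightarrow> laurent) \<Rightarrow> bool list \<Rightarrow> laurent" where
  "raise f [] = 0"
| "raise f (x # xs) = (if x then 0 else f (True # xs)) + weight x * raise (\<lambda>ys. f (x # ys)) xs"

text \<open>The coproduct E tensor 1 + K tensor E, split at an arbitrary place:
  \<open>weight\<close> gives the eigenvalues of K, and their product is picked up on passing
  \<open>xs\<close>.\<close>

lemma raise_append: "raise f (xs @ ys) = raise (\<lambda>us. f (us @ ys)) xs +
    prod_list (map weight xs) * raise (\<lambda>vs. f (xs @ vs)) ys"
  by (induction xs arbitrary: f) (simp_all add: algebra_simps)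

lemma raise_cong:
  "(\<And>ys. length ys = length xs \<Longrightarrow> f ys = g ys) \<Longrightarrow> raise f xs = raise g xs"
proof (induction xs arbitrary: f g)
  case (Cons x xs)
  have "raise (\<lambda>ys. f (x # ys)) xs = raise (\<lambda>ys. g (x # ys)) xs"
    by (rule Cons.IH) (simp add: Cons.prems)
  then show ?case by (simp add: Cons.prems)
qed simp

lemma raise_linear: "raise (\<lambda>ys. a * f ys + b * g ys) xs = a * raise f xs + b * raise g xs"
  by (induction xs arbitrary: f g) (simp_all add: algebra_simps)

lemma raise_diff: "raise (\<lambda>ys. f ys - c * g ys) xs = raise f xs - c * raise g xs"
  using raise_linear[of 1 f "- c" g] by simp

text \<open>The created pair is an invariant vector: K acts on it by \<open>hf * hi = 1\<close>, and
  E sends its two terms to the same state \<open>[True, True]\<close> with opposite coefficients.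
  \<open>raise_Cup\<close> is the dual computation.\<close>

lemma raise_Cap:
  assumes "i \<le> length xs"
  shows "raise (act (Cap d, i) f) xs = act (Cap d, i) (raise f) xs"
proof -
  obtain P R where xs: "xs = P @ R" and i: "length P = i"
    using assms by (rule split_zero)
  have "raise (\<lambda>us. act (Cap d, i) f (us @ R)) P =
     raise (\<lambda>us. f (us @ False # True # R) - hf * f (us @ True # False # R)) P"
    by (rule raise_cong) (simp add: act_at i)
  moreover have "raise (\<lambda>us. act (Cap d, i) f (P @ us)) R =
     raise (\<lambda>us. f (P @ False # True # us) - hf * f (P @ True # False # us)) R"
    by (rule raise_cong) (simp add: act_at i)
  ultimately show ?thesis
    unfolding xs raise_diff
    by (simp add: raise_append raise_diff act_at[OF i] weight_def hf_hi hi_hf hf_hi_cancel algebra_simps)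
qed

lemma raise_Cup:
  assumes "i + 1 < length xs"
  shows "raise (act (Cup, i) f) xs = act (Cup, i) (raise f) xs"
proof -
  obtain P a b R where xs: "xs = P @ a # b # R" and i: "length P = i"
    using assms by (rule split_two)
  have "raise (\<lambda>us. act (Cup, i) f (us @ a # b # R)) P =
     raise (\<lambda>us. cup_wt [a, b] * f (us @ R) + 0 * f us) P"
    by (rule raise_cong) (simp add: act_at i)
  moreover have "raise (\<lambda>us. act (Cup, i) f (P @ a # b # us)) R =
     raise (\<lambda>us. cup_wt [a, b] * f (P @ us) + 0 * f us) R"
    by (rule raise_cong) (simp add: act_at i)
  ultimately show ?thesis
    unfolding xs raise_linear
    by (cases a; cases b)
      (simp_all add: raise_append act_at[OF i] weight_def cup_wt_def hf_hi hi_hf hf_hi_cancel algebra_simps)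
qed

lemma raise_act:
  assumes "i + ins e \<le> length xs"
  shows "raise (act (e, i) f) xs = act (e, i) (raise f) xs"
proof (cases e)
  case (Cap d)
  then show ?thesis using assms raise_Cap by simp
next
  case Cup
  then show ?thesis using assms raise_Cup by simp
next
  case (Cross c)
  have l: "i + 1 < length xs" using assms Cross by simp
  have "raise (act (e, i) f) xs =
    raise (\<lambda>ys. 1 * f ys + (if c then hi else hf) * act (Cup, i) (act (Cap True, i) f) ys) xs"
    unfolding Cross using l by (intro raise_cong act_Cross_eq) simp
  also have "\<dots> = 1 * raise f xs +
      (if c then hi else hf) * act (Cup, i) (raise (act (Cap True, i) f)) xs"
    unfolding raise_linear raise_Cup[OF l] ..
  also have "act (Cup, i) (raise (act (Cap True, i) f)) xs =
      act (Cup, i) (act (Cap True, i) (raise f)) xs"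
    using l by (intro act_cong raise_Cap) auto
  also have "1 * raise f xs + (if c then hi else hf) * \<dots> = act (e, i) (raise f) xs"
    unfolding Cross act_Cross_eq[OF l, of c _ True] ..
  finally show ?thesis .
qed

lemma raise_state_sum:
  assumes "strands D os = Some []" "length xs = length os"
  shows "raise (state_sum D closed_state) xs = 0"
  using assms
proof (induction D arbitrary: os xs)
  case (Cons a D)
  obtain e i where a: "a = (e, i)" by force
  obtain os1 where 1: "slice (e, i) os = Some os1" "strands D os1 = Some []"
    using Cons.prems(1) a by (auto simp: bind_eq_Some_conv)
  have b: "i + ins e \<le> length os \<and> length os1 + ins e = length os + outs e"
    using slice_bounds[OF 1(1)] .
  have "raise (state_sum (a # D) closed_state) xs = act (e, i) (raise (state_sum D closed_state)) xs"
    using raise_act b Cons.prems(2) by (simp add: a)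
  also have "\<dots> = act (e, i) (\<lambda>_. 0) xs"
    using b Cons.prems(2) Cons.IH[OF 1(2)] by (intro act_cong) auto
  also have "\<dots> = 0" by (simp add: act.simps)
  finally show ?case .
qed simp

lemma state_value_divisible:
  assumes "link_diagram D"
  shows "\<exists>v. state_value D = - (hf + hi) * v"
proof -
  obtain e i D' os where D: "D = (e, i) # D'" and s: "slice (e, i) [] = Some os"
    and D': "strands D' os = Some []"
    using assms by (cases D) (auto simp: link_diagram_def bind_eq_Some_conv)
  obtain d where e: "e = Cap d" "i = 0"
    using slice_bounds[OF s] by (cases e) auto
  have "os = [d, \<not> d]" using s e by (simp add: circle_eval)
  \<comment> \<open>At two \<open>False\<close> spins, raising produces exactly the two mixed
    states, hence a linear relation between their values.\<close>
  then have "raise (state_sum D' closed_state) [False, False] = 0"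
    by (intro raise_state_sum[OF D']) simp
  then have "state_sum D' closed_state [True, False] = - hf * state_sum D' closed_state [False, True]"
    by (simp add: weight_def eq_neg_iff_add_eq_0)
  \<comment> \<open>The first maximum pairs the two mixed states to \<open>1 + hf * hf\<close>,
    which is \<open>hf * (hf + hi)\<close>.\<close>
  then have "state_sum D closed_state [] = - (hf + hi) * (- hf * state_sum D' closed_state [False, True])"
    by (simp add: D e circle_eval hf_hi hi_hf hf_hi_cancel algebra_simps)
  then show ?thesis
    unfolding state_value_def by (metis mult.left_commute)
qed

section \<open>The normalized invariant as a witness for \<open>is_jones\<close>\<close>

definition jones_val :: "diagram \<Rightarrow> laurent" where
  "jones_val D = (SOME v. state_value D = - (hf + hi) * v)"

lemma jones_val: "link_diagram D \<Longrightarrow> state_value D = - (hf + hi) * jones_val D"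
  unfolding jones_val_def using state_value_divisible by (metis (mono_tags, lifting) someI_ex)

lemma jones_val_unknot: "jones_val unknot = 1"
proof -
  have s: "link_diagram unknot" "state_value unknot = - (hf + hi)"
    using circle_eval(2)[of True]
    by (simp_all add: link_diagram_def unknot_def state_value_def wt_Cap_Cup cup_wt_def closed_state_def
        circle_eval)
  have "(hf + hi) * jones_val unknot = (hf + hi) * 1"
    using jones_val[OF s(1)] unfolding s(2) mult_minus_left by (simp only: neg_equal_iff_equal mult_1_right)
  then show ?thesis
    using loop_value_nonzero mult_left_cancel by blast
qed

lemma is_jones_jones_val: "is_jones jones_val"
  unfolding is_jones_def
proof (intro conjI allI impI jones_val_unknot)
  fix D D' assume "isotopic D D'"
  \<comment> \<open>\<open>jones_val\<close> sees a diagram only through its state value, so equal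
    state values yield the same choice.\<close>
  then show "jones_val D = jones_val D'"
    using state_value_isotopic by (simp add: jones_val_def)
next
  fix Dp Dn D0 assume t: "skein_triple Dp Dn D0"
  then have l: "link_diagram Dp" "link_diagram Dn" "link_diagram D0"
    by (simp_all add: skein_triple_def)
  have "(hf + hi) * (tpow (- 1) * jones_val Dp - tpow 1 * jones_val Dn + (hi - hf) * jones_val D0) = 0"
    using state_value_skein[OF t] unfolding l[THEN jones_val] by (simp add: algebra_simps)
  then show "tpow (- 1) * jones_val Dp - tpow 1 * jones_val Dn + (hi - hf) * jones_val D0 = 0"
    using loop_value_nonzero by (metis mult_eq_0_iff)
qed

lemma is_jones_jones: "is_jones jones"
  unfolding jones_def using is_jones_jones_val by (rule someI[of is_jones])

section \<open>Simplifying diagrams\<close>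

text \<open>\<open>isotopic\<close> compares complete link diagrams, so rewriting a fragment has to
  quantify over all completions. The relation is directed: after deleting a zigzag or a pair of
  crossings the fragment accepts more strand lists, and reinsertion might be ill-formed. Validity of
  the left side carries over to the right.\<close>

definition simplifies :: "diagram \<Rightarrow> diagram \<Rightarrow> bool" (infix "\<leadsto>" 50) where
  "l \<leadsto> r \<longleftrightarrow> (\<forall>xs ys. strands l xs = Some ys \<longrightarrow> strands r xs = Some ys \<and>
     (\<forall>A B. strands A [] = Some xs \<longrightarrow> link_diagram (A @ l @ B) \<longrightarrow>
        link_diagram (A @ r @ B) \<and> isotopic (A @ l @ B) (A @ r @ B)))"

lemma isotopic_refl: "isotopic D D"
  by (simp add: isotopic_def equivclp_def)

lemma isotopic_sym: "isotopic D D' \<Longrightarrow> isotopic D' D"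
  unfolding isotopic_def by (rule equivclp_sym)

lemma isotopic_trans: "isotopic D D' \<Longrightarrow> isotopic D' D'' \<Longrightarrow> isotopic D D''"
  unfolding isotopic_def equivclp_def by (rule rtranclp_trans)

lemma isotopic_step: "diagram_step D D' \<Longrightarrow> isotopic D D'"
  unfolding isotopic_def equivclp_def symclp_def by (rule r_into_rtranclp) simp

lemma simplifies_refl: "l \<leadsto> l"
  by (simp add: simplifies_def isotopic_refl)

lemma simplifies_trans [trans]: "l \<leadsto> m \<Longrightarrow> m \<leadsto> r \<Longrightarrow> l \<leadsto> r"
  unfolding simplifies_def by (meson isotopic_trans)

lemma simplifies_context:
  assumes "l \<leadsto> r"
  shows "C @ l @ E \<leadsto> C @ r @ E"
  unfolding simplifies_def
proof (intro allI impI)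
  fix xs ys assume "strands (C @ l @ E) xs = Some ys"
  then obtain us vs where 1: "strands C xs = Some us" "strands l us = Some vs" "strands E vs = Some ys"
    by (auto simp: strands_append bind_eq_Some_conv)
  from assms 1(2) have 2: "strands r us = Some vs"
    "\<And>A B. strands A [] = Some us \<Longrightarrow> link_diagram (A @ l @ B) \<Longrightarrow>
      link_diagram (A @ r @ B) \<and> isotopic (A @ l @ B) (A @ r @ B)"
    by (auto simp: simplifies_def)
  show "strands (C @ r @ E) xs = Some ys \<and> (\<forall>A B. strands A [] = Some xs \<longrightarrow>
      link_diagram (A @ (C @ l @ E) @ B) \<longrightarrow> link_diagram (A @ (C @ r @ E) @ B) \<and>
      isotopic (A @ (C @ l @ E) @ B) (A @ (C @ r @ E) @ B))"
  proof (intro conjI allI impI)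
    show "strands (C @ r @ E) xs = Some ys"
      using 1 2 by (simp add: strands_append)
    fix A B assume "strands A [] = Some xs" "link_diagram (A @ (C @ l @ E) @ B)"
    then have "link_diagram ((A @ C) @ r @ (E @ B)) \<and>
        isotopic ((A @ C) @ l @ (E @ B)) ((A @ C) @ r @ (E @ B))"
      using 1(1) by (intro 2(2)) (simp_all add: strands_append)
    then show "link_diagram (A @ (C @ r @ E) @ B)"
      "isotopic (A @ (C @ l @ E) @ B) (A @ (C @ r @ E) @ B)" by simp_all
  qed
qed

lemma simplifies_in:
  "l \<leadsto> r \<Longrightarrow> X = C @ l @ E \<Longrightarrow> Y = C @ r @ E \<Longrightarrow> X \<leadsto> Y"
  using simplifies_context by simp

text \<open>The last premise excludes passing to the empty list, which is not a link diagram: a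
  fragment may be deleted only if it needs strands entering from above.\<close>

lemma simplifiesI:
  assumes "\<And>xs ys. strands l xs = Some ys \<Longrightarrow> strands r xs = Some ys"
    and "move l r \<or> move r l" and "\<And>ys. r = [] \<Longrightarrow> strands l [] \<noteq> Some ys"
  shows "l \<leadsto> r"
  unfolding simplifies_def
proof (intro allI impI conjI)
  fix xs ys assume l: "strands l xs = Some ys"
  then show r: "strands r xs = Some ys" by (rule assms(1))
  fix A B assume A: "strands A [] = Some xs" and D: "link_diagram (A @ l @ B)"
  show D': "link_diagram (A @ r @ B)"
  proof -
    have "strands (A @ r @ B) [] = Some []"
      using A D l r by (simp add: link_diagram_def strands_append)
    moreover have "A @ r @ B \<noteq> []"
      using A l assms(3) by auto
    ultimately show ?thesis by (simp add: link_diagram_def)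
  qed
  have "diagram_step (A @ l @ B) (A @ r @ B) \<or> diagram_step (A @ r @ B) (A @ l @ B)"
    using assms(2) D D' unfolding diagram_step_def by blast
  then show "isotopic (A @ l @ B) (A @ r @ B)"
    using isotopic_step isotopic_sym by blast
qed

lemma simplifies_move:
  assumes "move l r"
  shows "l \<leadsto> r"
proof (rule simplifiesI)
  show "strands r xs = Some ys" if "strands l xs = Some ys" for xs ys
    using move_invariant[OF assms that refl] by simp
  show "strands l [] \<noteq> Some ys" if "r = []" for ys
    using assms that by cases (auto simp: bind_eq_Some_conv dest!: slice_bounds)
qed (use assms in simp)

lemma simplifies_exchange:
  assumes "j = i + outs e + k" "j' = i + ins e + k"
  shows "[(e, i), (f, j)] \<leadsto> [(f, j'), (e, i)]"
  using simplifies_move[OF exchange] assms by simp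

text \<open>Reversed moves need their own proof of admissibility, because
  \<open>move_invariant\<close> transports \<open>strands\<close> from left to right only.\<close>

lemma simplifies_exchange':
  assumes "j = i + outs e + k" "j' = i + ins e + k"
  shows "[(f, j'), (e, i)] \<leadsto> [(e, i), (f, j)]"
proof (rule simplifiesI)
  fix xs ys assume "strands [(f, j'), (e, i)] xs = Some ys"
  then obtain xs1 where s: "slice (f, j') xs = Some xs1" "slice (e, i) xs1 = Some ys"
    by (auto simp: bind_eq_Some_conv)
  obtain P zs R us where 1: "xs = P @ zs @ R" "length P = j'" "length zs = ins f"
    "local_slice f zs = Some us" "xs1 = P @ us @ R"
    using s(1) by (rule slice_SomeE)
  define p a q where "p = take i P" and "a = take (ins e) (drop i P)" and "q = drop (i + ins e) P"
  have P: "P = p @ a @ q"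
    unfolding p_def a_def q_def by (metis append_take_drop_id drop_drop add.commute)
  have l: "length p = i" "length a = ins e" "length q = k"
    using 1(2) assms(2) by (simp_all add: p_def a_def q_def)
  obtain vs where vs: "local_slice e a = Some vs" "ys = p @ vs @ q @ us @ R"
    using s(2) slice_append[of p i a e "q @ us @ R"] l by (auto simp: 1(5) P)
  have "length vs = outs e" using vs(1) by (rule local_slice_length)
  then show "strands [(e, i), (f, j)] xs = Some ys"
    using slice_append[of p i a e "q @ zs @ R"] slice_append[of "p @ vs @ q" j zs f R] l vs 1 assms
    by (simp add: P)
qed (use exchange[of e i f k] assms in auto)

lemma simplifies_slide_Cap:
  "[(Cap d, Suc i), (Cross c, i)] \<leadsto> [(Cap d, i), (Cross (\<not> c), Suc i)]"
proof (rule simplifiesI)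
  fix xs ys assume *: "strands [(Cap d, Suc i), (Cross c, i)] xs = Some ys"
  then have "i < length xs"
    by (auto simp: bind_eq_Some_conv dest!: slice_bounds)
  then obtain P a R where "xs = P @ a # R" "length P = i"
    by (rule split_one)
  then show "strands [(Cap d, i), (Cross (\<not> c), Suc i)] xs = Some ys"
    using * by (simp add: slice_at slice_at_Suc)
qed (use slide_Cap[of d i "\<not> c"] in auto)

lemma simplifies_slide_Cup:
  "[(Cross c, Suc i), (Cup, i)] \<leadsto> [(Cross (\<not> c), i), (Cup, Suc i)]"
proof (rule simplifiesI)
  fix xs ys assume *: "strands [(Cross c, Suc i), (Cup, i)] xs = Some ys"
  then have "i + 2 < length xs"
    by (auto simp: bind_eq_Some_conv dest!: slice_bounds)
  then obtain P a b c' R where "xs = P @ a # b # c' # R" "length P = i"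
    by (rule split_three)
  then show "strands [(Cross (\<not> c), i), (Cup, Suc i)] xs = Some ys"
    using * by (simp add: slice_at slice_at_Suc split: if_splits)
qed (use slide_Cup[of "\<not> c" i] in auto)

section \<open>Cancelling and transporting pieces\<close>

lemma simplifies_zigzag:
  "[(Cap d, Suc i), (Cup, i)] \<leadsto> []" "[(Cap d, i), (Cup, Suc i)] \<leadsto> []"
  using simplifies_move[OF zigzag_right] simplifies_move[OF zigzag_left] by simp_all

lemma simplifies_R2: "[(Cross c, i), (Cross (\<not> c), i)] \<leadsto> []"
  by (rule simplifies_move[OF R2])

text \<open>Each removed kink reverses the maximum, so \<open>d'\<close> depends on the parity of
  \<open>n\<close>; later uses only need its existence.\<close>

lemma simplifies_kinks_Cap: "\<exists>d'. (Cap d, i) # replicate n (Cross c, i) \<leadsto> [(Cap d', i)]"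
proof (induction n arbitrary: d)
  case 0
  then show ?case using simplifies_refl by auto
next
  case (Suc n)
  obtain d' where "(Cap (\<not> d), i) # replicate n (Cross c, i) \<leadsto> [(Cap d', i)]"
    using Suc by blast
  moreover have "(Cap d, i) # replicate (Suc n) (Cross c, i) \<leadsto>
      (Cap (\<not> d), i) # replicate n (Cross c, i)"
    by (rule simplifies_in[OF simplifies_move[OF R1_Cap[of d i c]], of _ "[]"]) simp_all
  ultimately show ?case using simplifies_trans by blast
qed

lemma replicate_snoc: "replicate n x @ [x] = x # replicate n x"
  by (simp add: replicate_append_same)

text \<open>The column stays where it is in the plane; its index changes because the piece at its
  left alters the number of strands there.\<close>

lemma simplifies_past_column:
  assumes "j = i + outs e + k" "j' = i + ins e + k"
  shows "(e, i) # replicate n (Cross c, j) \<leadsto> replicate n (Cross c, j') @ [(e, i)]"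
proof (induction n)
  case 0
  then show ?case by (simp add: simplifies_refl)
next
  case (Suc n)
  have "(e, i) # replicate (Suc n) (Cross c, j) \<leadsto> (Cross c, j') # (e, i) # replicate n (Cross c, j)"
    by (rule simplifies_in[OF simplifies_exchange[OF assms], of _ "[]"]) simp_all
  also have "\<dots> \<leadsto> replicate (Suc n) (Cross c, j') @ [(e, i)]"
    by (rule simplifies_in[OF Suc, of _ "[(Cross c, j')]" "[]"]) simp_all
  finally show ?case .
qed

lemma simplifies_before_column:
  assumes "j = i + outs e + k" "j' = i + ins e + k"
  shows "replicate n (Cross c, j') @ [(e, i)] \<leadsto> (e, i) # replicate n (Cross c, j)"
proof (induction n)
  case 0
  then show ?case by (simp add: simplifies_refl)
next
  case (Suc n)
  have "replicate (Suc n) (Cross c, j') @ [(e, i)] \<leadsto> (Cross c, j') # (e, i) # replicate n (Cross c, j)"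
    by (rule simplifies_in[OF Suc, of _ "[(Cross c, j')]" "[]"]) simp_all
  also have "\<dots> \<leadsto> (e, i) # replicate (Suc n) (Cross c, j)"
    by (rule simplifies_in[OF simplifies_exchange'[OF assms], of _ "[]"]) simp_all
  finally show ?case .
qed

lemma simplifies_right_of_column:
  "(Cross c, i + 2 + k) # replicate n (Cross c', i) \<leadsto> replicate n (Cross c', i) @ [(Cross c, i + 2 + k)]"
proof (induction n)
  case 0
  then show ?case by (simp add: simplifies_refl)
next
  case (Suc n)
  have "(Cross c, i + 2 + k) # replicate (Suc n) (Cross c', i) \<leadsto>
      (Cross c', i) # (Cross c, i + 2 + k) # replicate n (Cross c', i)"
    by (rule simplifies_in[OF simplifies_exchange'[of "i + 2 + k" i "Cross c'" k "i + 2 + k"], of _ "[]"])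
      simp_all
  also have "\<dots> \<leadsto> replicate (Suc n) (Cross c', i) @ [(Cross c, i + 2 + k)]"
    by (rule simplifies_in[OF Suc, of _ "[(Cross c', i)]" "[]"]) simp_all
  finally show ?case .
qed

text \<open>The two maxima are nested arcs. A crossing of their left legs slides over the top to
  their right legs: each of the two slides flips the type, so it is preserved overall, while the
  arcs exchange places and hence orientations.\<close>

lemma simplifies_turn:
  "[(Cap d, 0), (Cap (\<not> d), Suc 0), (Cross c, 0)] \<leadsto> [(Cap (\<not> d), 0), (Cap d, Suc 0), (Cross c, 2)]"
proof -
  have "[(Cap d, 0), (Cap (\<not> d), Suc 0), (Cross c, 0)] \<leadsto> [(Cap d, 0), (Cap (\<not> d), 0), (Cross (\<not> c), Suc 0)]"
    by (rule simplifies_in[OF simplifies_slide_Cap, where C = "[(Cap d, 0)]" and E = "[]"]) simp_all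
  also have "\<dots> \<leadsto> [(Cap (\<not> d), 0), (Cap d, 2), (Cross (\<not> c), Suc 0)]"
    by (rule simplifies_in[OF simplifies_exchange'[of 2 0 "Cap (\<not> d)" 0 0 "Cap d"], of _ "[]"]) simp_all
  also have "\<dots> \<leadsto> [(Cap (\<not> d), 0), (Cap d, Suc 0), (Cross c, 2)]"
    by (rule simplifies_in[OF simplifies_slide_Cap[of d "Suc 0" "\<not> c"], of _ "[(Cap (\<not> d), 0)]" "[]"])
      (simp_all add: numeral_2_eq_2)
  finally show ?thesis .
qed

lemma simplifies_turn_column:
  "\<exists>d'. [(Cap d, 0), (Cap (\<not> d), Suc 0)] @ replicate n (Cross c, 0) \<leadsto>
     [(Cap d', 0), (Cap (\<not> d'), Suc 0)] @ replicate n (Cross c, 2)"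
proof (induction n arbitrary: d)
  case 0
  then show ?case using simplifies_refl by auto
next
  case (Suc n)
  obtain d' where IH: "[(Cap (\<not> d), 0), (Cap d, Suc 0)] @ replicate n (Cross c, 0) \<leadsto>
     [(Cap d', 0), (Cap (\<not> d'), Suc 0)] @ replicate n (Cross c, 2)"
    using Suc[of "\<not> d"] by auto
  have "[(Cap d, 0), (Cap (\<not> d), Suc 0)] @ replicate (Suc n) (Cross c, 0) \<leadsto>
     [(Cap (\<not> d), 0), (Cap d, Suc 0)] @ (Cross c, 2) # replicate n (Cross c, 0)"
    by (rule simplifies_in[OF simplifies_turn, where C = "[]"]) simp_all
  also have "\<dots> \<leadsto> [(Cap (\<not> d), 0), (Cap d, Suc 0)] @ replicate n (Cross c, 0) @ [(Cross c, 2)]"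
    by (rule simplifies_in[OF simplifies_right_of_column[of c 0 0 n c],
        where C = "[(Cap (\<not> d), 0), (Cap d, Suc 0)]" and E = "[]"]) (simp_all add: numeral_2_eq_2)
  also have "\<dots> \<leadsto> [(Cap d', 0), (Cap (\<not> d'), Suc 0)] @ replicate n (Cross c, 2) @ [(Cross c, 2)]"
    by (rule simplifies_in[OF IH, of _ "[]" "[(Cross c, 2)]"]) simp_all
  finally show ?case by (auto simp: replicate_snoc)
qed

section \<open>Computing with the skein relation\<close>

lemma tpow_mult: "tpow a * tpow b = tpow (a + b)"
  by (simp add: tpow_def thalf_mult)

lemma tpow_mult_assoc: "tpow a * (tpow b * x) = tpow (a + b) * x"
  by (simp only: tpow_mult flip: mult.assoc)

lemma tpow_0: "tpow 0 = 1"
  by (simp add: tpow_def thalf_0)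

lemma add_neg_transfer:
  fixes x y z :: "'a::ab_group_add"
  assumes "x - y + z = 0"
  shows "y = x + z"
proof -
  have "y = x + z - (x - y + z)" by simp
  then show ?thesis using assms by simp
qed

lemma negative_skein:
  assumes "tpow (- 1) * x - tpow 1 * y + (hi - hf) * z = 0"
  shows "y = tpow (- 2) * x + tpow (- 1) * ((hi - hf) * z)"
proof -
  have "y = tpow (- 1) * (tpow 1 * y)"
    by (simp add: tpow_mult_assoc tpow_0)
  also have "tpow 1 * y = tpow (- 1) * x + (hi - hf) * z"
    using assms by (rule add_neg_transfer)
  finally show ?thesis
    unfolding distrib_left[of "tpow (- 1)"] tpow_mult_assoc by simp
qed

lemma positive_skein:
  assumes "tpow (- 1) * x - tpow 1 * y + (hi - hf) * z = 0"
  shows "x = tpow 2 * y - tpow 1 * ((hi - hf) * z)"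
proof -
  have "x = tpow 1 * (tpow (- 1) * x)"
    by (simp add: tpow_mult_assoc tpow_0)
  also have "tpow (- 1) * x = tpow 1 * y - (hi - hf) * z"
    unfolding add_neg_transfer[OF assms] by simp
  finally show ?thesis
    unfolding right_diff_distrib[of "tpow 1" "tpow 1 * y"] tpow_mult_assoc by simp
qed

lemma jones_simplifies:
  assumes "D \<leadsto> D'" "link_diagram D"
  shows "link_diagram D'" "jones D = jones D'"
proof -
  have "strands D [] = Some []" using assms(2) by (simp add: link_diagram_def)
  with assms(1) have "\<forall>A B. strands A [] = Some [] \<longrightarrow> link_diagram (A @ D @ B) \<longrightarrow>
        link_diagram (A @ D' @ B) \<and> isotopic (A @ D @ B) (A @ D' @ B)"
    by (auto simp: simplifies_def)
  from this[rule_format, of "[]" "[]"] assms(2)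
  have "link_diagram D' \<and> isotopic D D'" by simp
  then show "link_diagram D'" "jones D = jones D'"
    using is_jones_jones unfolding is_jones_def by blast+
qed

text \<open>\<open>is_jones\<close> fixes the value for one orientation only. A circle with one kink
  reduces to either orientation, depending on whether the kink is removed at the minimum or at the
  maximum.\<close>

lemma jones_unknot: "jones [(Cap d, 0), (Cup, 0)] = 1"
proof -
  have T: "jones [(Cap True, 0), (Cup, 0)] = 1"
    using is_jones_jones unfolding is_jones_def unknot_def by blast
  have l: "link_diagram [(Cap False, 0), (Cross True, 0), (Cup, 0)]"
    by (simp add: link_diagram_def slice.simps)
  have "[(Cap False, 0), (Cross True, 0), (Cup, 0)] \<leadsto> [(Cap False, 0), (Cup, 0)]"
    by (rule simplifies_in[OF simplifies_move[OF R1_Cup[of True 0]], where C = "[(Cap False, 0)]" and E = "[]"])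
      simp_all
  note 1 = jones_simplifies(2)[OF this l]
  have "[(Cap False, 0), (Cross True, 0), (Cup, 0)] \<leadsto> [(Cap True, 0), (Cup, 0)]"
    by (rule simplifies_in[OF simplifies_move[OF R1_Cap[of False 0 True]], where C = "[]" and E = "[(Cup, 0)]"])
      simp_all
  note 2 = jones_simplifies(2)[OF this l]
  then show ?thesis using T 1 2 by (cases d) simp_all
qed

text \<open>The antiparallel case, the one occurring in the columns: here \<open>Cross True\<close>
  is the positive crossing and the smoothing is a minimum above a maximum.\<close>

lemma jones_skein:
  assumes "strands A [] = Some xs" "link_diagram (A @ [(Cross c, i)] @ B)" "xs ! i = (\<not> b)" "xs ! Suc i = b"
  shows "tpow (- 1) * jones (A @ [(Cross True, i)] @ B) - tpow 1 * jones (A @ [(Cross False, i)] @ B)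
    + (hi - hf) * jones (A @ [(Cup, i), (Cap b, i)] @ B) = 0"
proof -
  have "i + 1 < length xs"
    using assms(1,2) by (auto simp: link_diagram_def strands_append bind_eq_Some_conv dest!: slice_bounds)
  then obtain P a b' R where "xs = P @ a # b' # R" and i: "length P = i"
    by (rule split_two)
  then have xs: "xs = P @ (\<not> b) # b # R" using assms(3,4) by (auto simp: nth_append)
  have s: "strands [(Cross x, i)] xs = Some (P @ b # (\<not> b) # R)"
    "strands [(Cup, i), (Cap b, i)] xs = Some (P @ b # (\<not> b) # R)" for x
    by (simp_all add: xs slice_at[OF i])
  have m: "strands (A @ m @ B) [] = Option.bind (strands m xs) (strands B)" for m
    using assms(1) by (simp add: strands_append)
  have l: "link_diagram (A @ [(Cross x, i)] @ B)"
    "link_diagram (A @ [(Cup, i), (Cap b, i)] @ B)" for x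
    using assms(2) unfolding link_diagram_def m s by simp_all
  have "skein_triple (A @ [(Cross True, i)] @ B) (A @ [(Cross False, i)] @ B)
     (A @ [(Cup, i), (Cap b, i)] @ B)"
    unfolding skein_triple_def
  proof (intro conjI l exI)
    show "A @ [(Cross False, i)] @ B = A @ [(Cross (\<not> True), i)] @ B" by simp
    show "A @ [(Cup, i), (Cap b, i)] @ B = A @ smoothing xs i @ B"
      using i by (auto simp: smoothing_def xs nth_append)
    show "positive_crossing xs i True"
      using assms(3,4) by (simp add: positive_crossing_def)
  qed (use assms in auto)
  then show ?thesis
    using is_jones_jones unfolding is_jones_def by blast
qed

lemma jones_two_circles: "jones [(Cap d, 0), (Cap (\<not> d), Suc 0), (Cup, Suc 0), (Cup, 0)] = - (hf + hi)"
proof -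
  \<comment> \<open>In \<open>?D\<close> two circles overlap in two crossings. Cancelling these
    directly leaves nested circles; sliding them around extrema before cancelling leaves circles
    side by side, which can be stacked.\<close>
  let ?D = "[(Cap d, 0), (Cap (\<not> d), Suc 0), (Cross False, 0), (Cross True, 0), (Cup, Suc 0), (Cup, 0)]"
  have l: "link_diagram ?D"
    by (cases d) (simp_all add: link_diagram_def slice.simps)
  have "?D \<leadsto> [(Cap d, 0), (Cap (\<not> d), Suc 0), (Cup, Suc 0), (Cup, 0)]"
    by (rule simplifies_in[OF simplifies_R2[of False 0], where C = "[(Cap d, 0), (Cap (\<not> d), Suc 0)]"
          and E = "[(Cup, Suc 0), (Cup, 0)]"]) simp_all
  then have 1: "jones ?D = jones [(Cap d, 0), (Cap (\<not> d), Suc 0), (Cup, Suc 0), (Cup, 0)]"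
    using l by (rule jones_simplifies(2))
  have "?D \<leadsto> [(Cap d, 0), (Cap (\<not> d), 0), (Cross True, Suc 0), (Cross True, 0), (Cup, Suc 0), (Cup, 0)]"
    by (rule simplifies_in[OF simplifies_slide_Cap[of "\<not> d" 0 False], where C = "[(Cap d, 0)]"
          and E = "[(Cross True, 0), (Cup, Suc 0), (Cup, 0)]"]) simp_all
  also have "\<dots> \<leadsto> [(Cap d, 0), (Cap (\<not> d), 0), (Cross True, Suc 0), (Cross False, Suc 0), (Cup, 0), (Cup, 0)]"
    by (rule simplifies_in[OF simplifies_move[OF slide_Cup[of True 0]],
          where C = "[(Cap d, 0), (Cap (\<not> d), 0), (Cross True, Suc 0)]" and E = "[(Cup, 0)]"]) simp_all
  also have "\<dots> \<leadsto> [(Cap d, 0), (Cap (\<not> d), 0), (Cup, 0), (Cup, 0)]"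
    by (rule simplifies_in[OF simplifies_R2[of True],
          where C = "[(Cap d, 0), (Cap (\<not> d), 0)]" and E = "[(Cup, 0), (Cup, 0)]"]) simp_all
  also have "\<dots> \<leadsto> [(Cap (\<not> d), 0), (Cap d, 2), (Cup, 0), (Cup, 0)]"
    by (rule simplifies_in[OF simplifies_exchange'[of 2 0 "Cap (\<not> d)" 0 0 "Cap d"],
          where C = "[]" and E = "[(Cup, 0), (Cup, 0)]"]) simp_all
  also have "\<dots> \<leadsto> [(Cap (\<not> d), 0), (Cup, 0), (Cap d, 0), (Cup, 0)]"
    by (rule simplifies_in[OF simplifies_exchange'[of 0 0 Cup 0 2],
          where C = "[(Cap (\<not> d), 0)]" and E = "[(Cup, 0)]"]) simp_all
  finally have 2: "jones ?D = jones [(Cap (\<not> d), 0), (Cup, 0), (Cap d, 0), (Cup, 0)]"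
    using l by (rule jones_simplifies(2))
  have l: "link_diagram [(Cap (\<not> d), 0), (Cross c, 0), (Cup, 0)]" for c
    by (simp add: link_diagram_def slice.simps)
  have kink: "jones [(Cap (\<not> d), 0), (Cross c, 0), (Cup, 0)] = 1" for c
  proof -
    have "[(Cap (\<not> d), 0), (Cross c, 0), (Cup, 0)] \<leadsto> [(Cap (\<not> d), 0), (Cup, 0)]"
      by (rule simplifies_in[OF simplifies_move[OF R1_Cup[of c 0]], where C = "[(Cap (\<not> d), 0)]" and E = "[]"])
        simp_all
    from jones_simplifies(2)[OF this l] show ?thesis
      unfolding jones_unknot .
  qed
  \<comment> \<open>Both crossings turn the circle into a kinked unknot of value 1, and the
    smoothing is the pair of stacked circles.\<close>
  have "tpow (- 1) - tpow 1 + (hi - hf) * jones [(Cap (\<not> d), 0), (Cup, 0), (Cap d, 0), (Cup, 0)] = 0"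
    using jones_skein[of "[(Cap (\<not> d), 0)]" "[\<not> d, d]" True 0 "[(Cup, 0)]" d] kink
    by (simp add: link_diagram_def slice.simps)
  then have "(hi - hf) * jones [(Cap (\<not> d), 0), (Cup, 0), (Cap d, 0), (Cup, 0)] = (hi - hf) * (- (hf + hi))"
    by (simp add: tpow_1_eq algebra_simps)
  moreover have "hi - hf \<noteq> 0"
  proof
    assume "hi - hf = 0"
    then have "Poly_Mapping.lookup (hi - hf) 1 = 0" by simp
    then show False by (simp add: thalf_def lookup_minus lookup_single)
  qed
  ultimately show ?thesis using 1 2 by simp
qed

section \<open>Antiparallel (2,n) torus links\<close>

lemma strands_column:
  assumes "length P = i"
  shows "strands (replicate n (Cross c, i)) (P @ a # b # R) =
    Some (if even n then P @ a # b # R else P @ b # a # R)"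
  by (induction n arbitrary: a b) (auto simp: slice_at[OF assms])

lemma strands_columns:
  "strands (replicate n (Cross c, 0)) (a # b # R) = Some (if even n then a # b # R else b # a # R)"
  "strands (replicate n (Cross c, 2)) (x # y # a # b # R) =
     Some (if even n then x # y # a # b # R else x # y # b # a # R)"
  "strands (replicate n (Cross c, 4)) (x # y # z # w # a # b # R) =
     Some (if even n then x # y # z # w # a # b # R else x # y # z # w # b # a # R)"
  using strands_column[of "[]" 0] strands_column[of "[x, y]" 2] strands_column[of "[x, y, z, w]" 4]
  by simp_all

text \<open>For even \<open>n\<close>, the boundary of an annulus with \<open>n\<close> half-twists,
  all on the right legs of the nested arcs. The orientation \<open>d\<close> is kept as a parameter
  because kinks and turns reverse it.\<close>

definition torus :: "bool \<Rightarrow> nat \<Rightarrow> diagram" where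
  "torus d n = [(Cap d, 0), (Cap (\<not> d), Suc 0)] @ replicate n (Cross False, 2) @ [(Cup, Suc 0), (Cup, 0)]"

lemma link_torus: "even n \<Longrightarrow> link_diagram (torus d n)"
  by (simp add: torus_def link_diagram_def strands_append strands_columns slice.simps)

text \<open>Smoothing one crossing cuts the annulus open: the other \<open>n + 1\<close> crossings
  become kinks at the new maximum, and an unknot remains.\<close>

lemma jones_torus_rec:
  assumes "even n"
  shows "jones (torus d (Suc (Suc n))) = tpow (- 2) * jones (torus d n) + tpow (- 1) * (hi - hf)"
proof -
  let ?A = "[(Cap d, 0), (Cap (\<not> d), Suc 0)]" and ?E = "[(Cup, Suc 0), (Cup, 0)]"
  let ?B = "(Cross False, 2) # replicate n (Cross False, 2) @ ?E"
  have l: "link_diagram (?A @ [(Cross False, 2)] @ ?B)"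
    using link_torus[of "Suc (Suc n)" d] assms by (simp add: torus_def)
  have l': "link_diagram (?A @ [(Cross True, 2)] @ ?B)"
    "link_diagram (?A @ [(Cup, 2), (Cap (\<not> d), 2)] @ ?B)"
    using assms by (simp_all add: link_diagram_def strands_append strands_columns slice.simps)
  have "?A @ [(Cross True, 2)] @ ?B \<leadsto> torus d n"
    by (rule simplifies_in[OF simplifies_R2[of True],
          where C = ?A and E = "replicate n (Cross False, 2) @ ?E"]) (simp_all add: torus_def)
  then have 1: "jones (?A @ [(Cross True, 2)] @ ?B) = jones (torus d n)"
    using l'(1) by (rule jones_simplifies(2))
  obtain d' where d': "(Cap (\<not> d), 2) # replicate (Suc n) (Cross False, 2) \<leadsto> [(Cap d', 2)]"
    using simplifies_kinks_Cap by blast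
  have "?A @ [(Cup, 2), (Cap (\<not> d), 2)] @ ?B \<leadsto> ?A @ [(Cup, 2), (Cap d', 2)] @ ?E"
    by (rule simplifies_in[OF d', where C = "?A @ [(Cup, 2)]" and E = ?E]) simp_all
  also have "\<dots> \<leadsto> [(Cap d, 0), (Cap d', 2)] @ ?E"
    by (rule simplifies_in[OF simplifies_zigzag(2)[of _ "Suc 0"], where C = "[(Cap d, 0)]" and E = "(Cap d', 2) # ?E"])
      (simp_all add: numeral_2_eq_2)
  also have "\<dots> \<leadsto> [(Cap d, 0), (Cup, 0)]"
    by (rule simplifies_in[OF simplifies_zigzag(1)[of _ "Suc 0"], where C = "[(Cap d, 0)]" and E = "[(Cup, 0)]"])
      (simp_all add: numeral_2_eq_2)
  finally have 2: "jones (?A @ [(Cup, 2), (Cap (\<not> d), 2)] @ ?B) = 1"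
    using jones_simplifies(2)[OF _ l'(2)] unfolding jones_unknot[of d, symmetric] by blast
  have A: "strands ?A [] = Some [d, \<not> d, d, \<not> d]"
    by (simp add: slice.simps)
  have 3: "?A @ [(Cross False, 2)] @ ?B = torus d (Suc (Suc n))"
    by (simp add: torus_def)
  have "[d, \<not> d, d, \<not> d] ! 2 = (\<not> (\<not> d))" "[d, \<not> d, d, \<not> d] ! Suc 2 = (\<not> d)"
    by simp_all
  from negative_skein[OF jones_skein[OF A l this]] show ?thesis
    unfolding 1 2 3 mult_1_right .
qed

lemma circle_square: "(hf + hi) * (hf + hi) = tpow 1 + 2 + tpow (- 1)"
  by (simp add: tpow_1_eq hf_hi hi_hf algebra_simps)

lemma circle_skein: "(hi - hf) * (hf + hi) = tpow (- 1) - tpow 1"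
  by (simp add: tpow_1_eq algebra_simps)

text \<open>After multiplication by \<open>hf + hi\<close> the recursion has the fixed point -1 and
  contracts by \<open>tpow (- 2)\<close>. At \<open>m = 0\<close> there are two circles, so the
  deviation from -1 is \<open>1 - (hf + hi)^2\<close>.\<close>

lemma jones_torus:
  "(hf + hi) * jones (torus d (2 * m)) = - 1 - tpow (- 2 * int m) * (tpow 1 + 1 + tpow (- 1))"
proof (induction m)
  case 0
  have "jones (torus d (2 * 0)) = - (hf + hi)"
    using jones_two_circles by (simp add: torus_def)
  then have "(hf + hi) * jones (torus d (2 * 0)) = - ((hf + hi) * (hf + hi))"
    by (simp only: mult_minus_right)
  then show ?case unfolding circle_square by (simp add: tpow_0)
next
  case (Suc m)
  have "(hf + hi) * jones (torus d (2 * Suc m)) =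
      (hf + hi) * (tpow (- 2) * jones (torus d (2 * m)) + tpow (- 1) * (hi - hf))"
    using jones_torus_rec[of "2 * m" d] by simp
  also have "\<dots> = tpow (- 2) * ((hf + hi) * jones (torus d (2 * m))) + tpow (- 1) * ((hi - hf) * (hf + hi))"
    by (simp only: distrib_left mult.left_commute mult.commute)
  finally show ?case
    unfolding Suc circle_skein by (simp add: tpow_mult tpow_0 algebra_simps)
qed

lemma simplifies_bands:
  "\<exists>d'. [(Cap d, 0), (Cap (\<not> d), Suc 0)] @ replicate m (Cross False, 0) @ replicate n (Cross False, 2)
     @ [(Cup, Suc 0), (Cup, 0)] \<leadsto> torus d' (m + n)"
proof -
  obtain d' where "[(Cap d, 0), (Cap (\<not> d), Suc 0)] @ replicate m (Cross False, 0) \<leadsto>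
     [(Cap d', 0), (Cap (\<not> d'), Suc 0)] @ replicate m (Cross False, 2)"
    using simplifies_turn_column by blast
  from simplifies_in[OF this, where C = "[]" and E = "replicate n (Cross False, 2) @ [(Cup, Suc 0), (Cup, 0)]"]
  show ?thesis by (auto simp: torus_def replicate_add)
qed

text \<open>Turned over the arcs, the \<open>Cross True\<close> lands on top of a column of
  \<open>Cross False\<close> and cancels its first crossing.\<close>

lemma simplifies_opposite_bands:
  "[(Cap d, 0), (Cap (\<not> d), Suc 0)] @ [(Cross True, 0)] @ replicate (Suc n) (Cross False, 2)
     @ [(Cup, Suc 0), (Cup, 0)] \<leadsto> torus (\<not> d) n"
proof -
  let ?E = "replicate (Suc n) (Cross False, 2) @ [(Cup, Suc 0), (Cup, 0)]"
  have "[(Cap d, 0), (Cap (\<not> d), Suc 0)] @ [(Cross True, 0)] @ ?E \<leadsto>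
      [(Cap (\<not> d), 0), (Cap d, Suc 0)] @ [(Cross True, 2)] @ ?E"
    by (rule simplifies_in[OF simplifies_turn[of d True], where C = "[]" and E = ?E]) simp_all
  also have "\<dots> \<leadsto> torus (\<not> d) n"
    by (rule simplifies_in[OF simplifies_R2[of True], where C = "[(Cap (\<not> d), 0), (Cap d, Suc 0)]"
          and E = "replicate n (Cross False, 2) @ [(Cup, Suc 0), (Cup, 0)]"]) (simp_all add: torus_def)
  finally show ?thesis .
qed

section \<open>Pretzel knots\<close>

abbreviation maxima :: diagram where
  "maxima \<equiv> [(Cap True, 0), (Cap False, Suc 0), (Cap False, 3)]"

abbreviation minima :: diagram where
  "minima \<equiv> [(Cup, Suc 0), (Cup, Suc 0), (Cup, 0)]"

text \<open>Separate natural lengths with fixed crossing types, since the recursions shorten the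
  left and middle columns independently.\<close>

definition pretzel_columns :: "nat \<Rightarrow> nat \<Rightarrow> nat \<Rightarrow> diagram" where
  "pretzel_columns l m n = maxima @ replicate l (Cross True, 0) @ replicate m (Cross False, 2) @
     replicate n (Cross False, 4) @ minima"

lemma pretzel_eq_columns:
  "pretzel (- (2 * int s + 1)) (2 * int s + 1) (2 * int i + 1) = pretzel_columns (2 * s + 1) (2 * s + 1) (2 * i + 1)"
proof -
  have "nat \<bar>2 * int k + 1\<bar> = 2 * k + 1" for k by simp
  then show ?thesis
    unfolding pretzel_def pretzel_columns_def column_def abs_minus_cancel by simp
qed

lemma strands_maxima: "strands maxima [] = Some [True, False, True, False, True, False]"
  by (simp add: slice.simps numeral_3_eq_3)

lemma link_pretzel_columns:
  assumes "odd l" "odd m" "odd n"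
  shows "link_diagram (pretzel_columns l m n)"
  using assms
  by (simp add: link_diagram_def pretzel_columns_def strands_append strands_columns slice.simps numeral_3_eq_3)

text \<open>The rest of the left column is absorbed as kinks by the new maximum. The two arcs of the
  smoothing then straighten out, one against the lower minima and one against the upper maxima, so
  the remaining columns move two places left.\<close>

lemma smoothing_left:
  "\<exists>d'. maxima @ [(Cup, 0), (Cap d, 0)] @ replicate l (Cross True, 0) @ replicate m (Cross False, 2) @
     replicate n (Cross False, 4) @ minima \<leadsto> torus d' (m + n)"
proof -
  let ?E = "[(Cup, Suc 0), (Cup, 0)] :: diagram"
  let ?m = "replicate m (Cross False, 2)" and ?m' = "replicate m (Cross False, 0)"
  let ?n = "replicate n (Cross False, 4)" and ?n' = "replicate n (Cross False, 2)"
  obtain d1 where d1: "(Cap d, 0) # replicate l (Cross True, 0) \<leadsto> [(Cap d1, 0)]"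
    using simplifies_kinks_Cap by blast
  have "maxima @ [(Cup, 0), (Cap d, 0)] @ replicate l (Cross True, 0) @ ?m @ ?n @ minima \<leadsto>
      maxima @ [(Cup, 0), (Cap d1, 0)] @ ?m @ ?n @ minima"
    by (rule simplifies_in[OF d1, where C = "maxima @ [(Cup, 0)]" and E = "?m @ ?n @ minima"]) simp_all
  also have "\<dots> \<leadsto> maxima @ [(Cup, 0)] @ ?m' @ [(Cap d1, 0)] @ ?n @ minima"
    by (rule simplifies_in[OF simplifies_past_column[of 2 0 "Cap d1" 0 0 m False],
          where C = "maxima @ [(Cup, 0)]" and E = "?n @ minima"]) simp_all
  also have "\<dots> \<leadsto> maxima @ [(Cup, 0)] @ ?m' @ ?n' @ [(Cap d1, 0)] @ minima"
    by (rule simplifies_in[OF simplifies_past_column[of 4 0 "Cap d1" 2 2 n False],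
          where C = "maxima @ [(Cup, 0)] @ ?m'" and E = minima]) simp_all
  also have "\<dots> \<leadsto> maxima @ [(Cup, 0)] @ ?m' @ ?n' @ ?E"
    by (rule simplifies_in[OF simplifies_zigzag(2)[of d1 0],
          where C = "maxima @ [(Cup, 0)] @ ?m' @ ?n'" and E = ?E]) simp_all
  also have "\<dots> \<leadsto> [(Cap True, 0), (Cap False, Suc 0), (Cup, 0), (Cap False, Suc 0)] @ ?m' @ ?n' @ ?E"
    by (rule simplifies_in[OF simplifies_exchange'[of "Suc 0" 0 Cup "Suc 0" 3 "Cap False"],
          where C = "[(Cap True, 0), (Cap False, Suc 0)]" and E = "?m' @ ?n' @ ?E"]) simp_all
  also have "\<dots> \<leadsto> [(Cap True, 0), (Cap False, Suc 0)] @ ?m' @ ?n' @ ?E"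
    by (rule simplifies_in[OF simplifies_zigzag(1)[of False 0],
          where C = "[(Cap True, 0)]" and E = "[(Cap False, Suc 0)] @ ?m' @ ?n' @ ?E"]) simp_all
  finally show ?thesis
    using simplifies_bands[of True m n] simplifies_trans by force
qed

text \<open>The middle column disappears in kinks, and the lone left crossing cancels one crossing
  of the right column; this is why \<open>Suc n\<close> becomes \<open>n\<close>.\<close>

lemma smoothing_middle:
  "maxima @ [(Cross True, 0), (Cup, 2), (Cap d, 2)] @ replicate m (Cross False, 2) @
     replicate (Suc n) (Cross False, 4) @ minima \<leadsto> torus False n"
proof -
  let ?E = "[(Cup, Suc 0), (Cup, 0)] :: diagram"
  let ?n = "replicate (Suc n) (Cross False, 4)" and ?n' = "replicate (Suc n) (Cross False, 2)"
  obtain d1 where d1: "(Cap d, 2) # replicate m (Cross False, 2) \<leadsto> [(Cap d1, 2)]"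
    using simplifies_kinks_Cap by blast
  have "maxima @ [(Cross True, 0), (Cup, 2), (Cap d, 2)] @ replicate m (Cross False, 2) @ ?n @ minima \<leadsto>
      maxima @ [(Cross True, 0), (Cup, 2), (Cap d1, 2)] @ ?n @ minima"
    by (rule simplifies_in[OF d1, where C = "maxima @ [(Cross True, 0), (Cup, 2)]" and E = "?n @ minima"]) simp_all
  also have "\<dots> \<leadsto> maxima @ [(Cross True, 0), (Cup, 2)] @ ?n' @ [(Cap d1, 2)] @ minima"
    by (rule simplifies_in[OF simplifies_past_column[of 4 2 "Cap d1" 0 2 "Suc n" False],
          where C = "maxima @ [(Cross True, 0), (Cup, 2)]" and E = minima]) simp_all
  also have "\<dots> \<leadsto> maxima @ [(Cross True, 0), (Cup, 2)] @ ?n' @ ?E"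
    by (rule simplifies_in[OF simplifies_zigzag(1)[of d1 "Suc 0"],
          where C = "maxima @ [(Cross True, 0), (Cup, 2)] @ ?n'" and E = ?E])
      (simp_all add: numeral_2_eq_2)
  also have "\<dots> \<leadsto> maxima @ [(Cup, 2), (Cross True, 0)] @ ?n' @ ?E"
    by (rule simplifies_in[OF simplifies_exchange[of 2 0 "Cross True" 0 2 Cup],
          where C = maxima and E = "?n' @ ?E"]) simp_all
  also have "\<dots> \<leadsto> [(Cap True, 0), (Cap (\<not> True), Suc 0)] @ [(Cross True, 0)] @ ?n' @ ?E"
    by (rule simplifies_in[OF simplifies_zigzag(1)[of False 2],
          where C = "[(Cap True, 0), (Cap False, Suc 0)]" and E = "[(Cross True, 0)] @ ?n' @ ?E"])
      (simp_all add: numeral_3_eq_3 numeral_2_eq_2)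
  also have "\<dots> \<leadsto> torus (\<not> True) n" by (rule simplifies_opposite_bands)
  finally show ?thesis by simp
qed

text \<open>The two opposite crossings can be brought into the gap between their columns, one along
  a maximum and the other along a minimum, where they cancel. The right column is left as
  kinks.\<close>

lemma simplifies_pretzel_1_1: "pretzel_columns (Suc 0) (Suc 0) n \<leadsto> [(Cap False, 0), (Cup, 0)]"
proof -
  let ?n = "replicate n (Cross False, 4)" and ?n' = "replicate n (Cross False, 2)"
  let ?E = "[(Cup, Suc 0), (Cup, 0)] :: diagram"
  obtain d' where d': "(Cap True, 2) # replicate n (Cross False, 2) \<leadsto> [(Cap d', 2)]"
    using simplifies_kinks_Cap by blast
  have "pretzel_columns (Suc 0) (Suc 0) n \<leadsto> maxima @ [(Cross True, 0), (Cross False, 2), (Cup, Suc 0)] @ ?n' @ ?E"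
    by (rule simplifies_in[OF simplifies_before_column[of 2 "Suc 0" Cup "Suc 0" 4 n False],
          where C = "maxima @ [(Cross True, 0), (Cross False, 2)]" and E = ?E]) (simp_all add: pretzel_columns_def)
  \<comment> \<open>Reordering the last two maxima brings the one between the first two columns next
    to the crossing, so that the slide applies.\<close>
  also have "\<dots> \<leadsto> [(Cap True, 0), (Cap False, Suc 0), (Cap False, Suc 0), (Cross True, 0),
      (Cross False, 2), (Cup, Suc 0)] @ ?n' @ ?E"
    by (rule simplifies_in[OF simplifies_exchange[of 3 "Suc 0" "Cap False" 0 "Suc 0" "Cap False"],
          where C = "[(Cap True, 0)]" and E = "[(Cross True, 0), (Cross False, 2), (Cup, Suc 0)] @ ?n' @ ?E"])
      simp_all
  also have "\<dots> \<leadsto> [(Cap True, 0), (Cap False, Suc 0), (Cap False, 0), (Cross False, Suc 0),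
      (Cross False, 2), (Cup, Suc 0)] @ ?n' @ ?E"
    by (rule simplifies_in[OF simplifies_slide_Cap[of False 0 True],
          where C = "[(Cap True, 0), (Cap False, Suc 0)]" and E = "[(Cross False, 2), (Cup, Suc 0)] @ ?n' @ ?E"])
      simp_all
  also have "\<dots> \<leadsto> [(Cap True, 0), (Cap False, Suc 0), (Cap False, 0), (Cross False, Suc 0),
      (Cross True, Suc 0), (Cup, 2)] @ ?n' @ ?E"
    by (rule simplifies_in[OF simplifies_slide_Cup[of False "Suc 0"],
          where C = "[(Cap True, 0), (Cap False, Suc 0), (Cap False, 0), (Cross False, Suc 0)]"
            and E = "?n' @ ?E"]) (simp_all add: numeral_2_eq_2)
  also have "\<dots> \<leadsto> [(Cap True, 0), (Cap False, Suc 0), (Cap False, 0), (Cup, 2)] @ ?n' @ ?E"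
    by (rule simplifies_in[OF simplifies_R2[of False "Suc 0"],
          where C = "[(Cap True, 0), (Cap False, Suc 0), (Cap False, 0)]"
            and E = "(Cup, 2) # ?n' @ ?E"]) simp_all
  also have "\<dots> \<leadsto> [(Cap True, 0), (Cap False, Suc 0), (Cup, 0), (Cap False, 0)] @ ?n' @ ?E"
    by (rule simplifies_in[OF simplifies_exchange[of 2 0 "Cap False" 0 0 Cup],
          where C = "[(Cap True, 0), (Cap False, Suc 0)]" and E = "?n' @ ?E"]) simp_all
  also have "\<dots> \<leadsto> [(Cap True, 0), (Cap False, 0)] @ ?n' @ ?E"
    by (rule simplifies_in[OF simplifies_zigzag(1)[of False 0],
          where C = "[(Cap True, 0)]" and E = "(Cap False, 0) # ?n' @ ?E"]) simp_all
  also have "\<dots> \<leadsto> [(Cap False, 0), (Cap True, 2)] @ ?n' @ ?E"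
    by (rule simplifies_in[OF simplifies_exchange'[of 2 0 "Cap False" 0 0 "Cap True"],
          where C = "[]" and E = "?n' @ ?E"]) simp_all
  also have "\<dots> \<leadsto> [(Cap False, 0), (Cap d', 2)] @ ?E"
    by (rule simplifies_in[OF d', where C = "[(Cap False, 0)]" and E = ?E]) simp_all
  also have "\<dots> \<leadsto> [(Cap False, 0), (Cup, 0)]"
    by (rule simplifies_in[OF simplifies_zigzag(1)[of d' "Suc 0"],
          where C = "[(Cap False, 0)]" and E = "[(Cup, 0)]"]) (simp_all add: numeral_2_eq_2)
  finally show ?thesis .
qed

lemma jones_pretzel_1_1: "odd n \<Longrightarrow> jones (pretzel_columns (Suc 0) (Suc 0) n) = 1"
  using jones_simplifies(2)[OF simplifies_pretzel_1_1 link_pretzel_columns] jones_unknot by simp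

section \<open>Recursions in the column lengths\<close>

lemma jones_pretzel_left:
  assumes "odd l" "odd m" "odd n"
  shows "\<exists>d. jones (pretzel_columns (Suc (Suc l)) m n) =
    tpow 2 * jones (pretzel_columns l m n) - tpow 1 * ((hi - hf) * jones (torus d (m + n)))"
proof -
  let ?R = "replicate m (Cross False, 2) @ replicate n (Cross False, 4) @ minima"
  let ?B = "replicate (Suc l) (Cross True, 0) @ ?R"
  have 1: "maxima @ [(Cross True, 0)] @ ?B = pretzel_columns (Suc (Suc l)) m n"
    by (simp add: pretzel_columns_def)
  have l: "link_diagram (maxima @ [(Cross True, 0)] @ ?B)"
    unfolding 1 using link_pretzel_columns assms by simp
  have l': "link_diagram (maxima @ [(Cross False, 0)] @ ?B)"
    "link_diagram (maxima @ [(Cup, 0), (Cap False, 0)] @ ?B)"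
    using l by (simp_all add: link_diagram_def strands_append strands_maxima slice.simps del: strands.simps(2))
      (simp_all add: slice.simps)
  have "maxima @ [(Cross False, 0)] @ ?B \<leadsto> pretzel_columns l m n"
    by (rule simplifies_in[OF simplifies_R2[of False 0], where C = maxima
          and E = "replicate l (Cross True, 0) @ ?R"]) (simp_all add: pretzel_columns_def)
  note 2 = jones_simplifies(2)[OF this l'(1)]
  obtain d where "maxima @ [(Cup, 0), (Cap False, 0)] @ ?B \<leadsto> torus d (m + n)"
    using smoothing_left by blast
  note 3 = jones_simplifies(2)[OF this l'(2)]
  have "[True, False, True, False, True, False] ! 0 = (\<not> False)"
    "[True, False, True, False, True, False] ! Suc 0 = False" by simp_all
  from positive_skein[OF jones_skein[OF strands_maxima l this]] show ?thesis
    unfolding 1 2 3 by blast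
qed

lemma jones_pretzel_middle:
  assumes "odd m" "even n"
  shows "jones (pretzel_columns (Suc 0) (Suc (Suc m)) (Suc n)) =
    tpow (- 2) * jones (pretzel_columns (Suc 0) m (Suc n)) + tpow (- 1) * ((hi - hf) * jones (torus False n))"
proof -
  let ?A = "maxima @ [(Cross True, 0)]"
  let ?R = "replicate (Suc n) (Cross False, 4) @ minima"
  let ?B = "replicate (Suc m) (Cross False, 2) @ ?R"
  have A: "strands ?A [] = Some [False, True, True, False, True, False]"
    unfolding strands_append strands_maxima by (simp add: slice.simps)
  have 1: "?A @ [(Cross False, 2)] @ ?B = pretzel_columns (Suc 0) (Suc (Suc m)) (Suc n)"
    by (simp add: pretzel_columns_def)
  have l: "link_diagram (?A @ [(Cross False, 2)] @ ?B)"
    unfolding 1 using link_pretzel_columns assms by simp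
  have l': "link_diagram (?A @ [(Cross True, 2)] @ ?B)"
    "link_diagram (?A @ [(Cup, 2), (Cap False, 2)] @ ?B)"
    using l unfolding link_diagram_def strands_append A by (simp_all add: slice.simps)
  have "?A @ [(Cross True, 2)] @ ?B \<leadsto> pretzel_columns (Suc 0) m (Suc n)"
    by (rule simplifies_in[OF simplifies_R2[of True 2], where C = ?A
          and E = "replicate m (Cross False, 2) @ ?R"]) (simp_all add: pretzel_columns_def)
  note 2 = jones_simplifies(2)[OF this l'(1)]
  have "?A @ [(Cup, 2), (Cap False, 2)] @ ?B \<leadsto> torus False n"
    using smoothing_middle[of False "Suc m" n] by simp
  note 3 = jones_simplifies(2)[OF this l'(2)]
  have "[False, True, True, False, True, False] ! 2 = (\<not> False)"
    "[False, True, True, False, True, False] ! Suc 2 = False" by simp_all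
  from negative_skein[OF jones_skein[OF A l this]] show ?thesis
    unfolding 1 2 3 .
qed

text \<open>With X = z^2 J and Y = z T, where z = \<open>hf + hi\<close>, the skein step reads X' =
  t^-2 X + (t^-2 - 1) Y. Hence X + Y is merely scaled by t^-2, and X = z^2 at the anchor.\<close>

lemma jones_pretzel_1:
  assumes "even n"
  shows "(hf + hi) * ((hf + hi) * jones (pretzel_columns (Suc 0) (Suc (2 * m)) (Suc n))) +
      (hf + hi) * jones (torus False n) =
    tpow (- 2 * int m) * ((hf + hi) * (hf + hi) + (hf + hi) * jones (torus False n))"
proof (induction m)
  case 0
  show ?case using jones_pretzel_1_1[of "Suc n"] assms by (simp add: tpow_0)
next
  case (Suc m)
  let ?z = "hf + hi" and ?T = "jones (torus False n)"
  let ?J = "\<lambda>m. jones (pretzel_columns (Suc 0) (Suc (2 * m)) (Suc n))"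
  have "?J (Suc m) = tpow (- 2) * ?J m + tpow (- 1) * ((hi - hf) * ?T)"
    using jones_pretzel_middle[of "Suc (2 * m)" n] assms by simp
  then have "?z * (?z * ?J (Suc m)) + ?z * ?T =
      tpow (- 2) * (?z * (?z * ?J m)) + tpow (- 1) * (((hi - hf) * ?z) * (?z * ?T)) + ?z * ?T"
    by (simp only: distrib_left[of ?z] mult.assoc mult.left_commute)
  also have "\<dots> = tpow (- 2) * (?z * (?z * ?J m) + ?z * ?T)"
    unfolding circle_skein
    by (simp only: distrib_left left_diff_distrib right_diff_distrib tpow_mult_assoc) (simp add: tpow_0)
  finally show ?case
    unfolding Suc tpow_mult_assoc by (simp add: algebra_simps)
qed

text \<open>Here X' = t^2 X + (t^2 - 1) w, so X + w scales by t^2. The orientation \<open>d\<close>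
  of the torus link may differ from step to step, hence one value \<open>w\<close> is assumed for
  all \<open>d\<close>.\<close>

lemma jones_pretzel:
  assumes "odd m" "odd n"
    and w: "\<And>d. (hf + hi) * jones (torus d (m + n)) = w"
  shows "(hf + hi) * ((hf + hi) * jones (pretzel_columns (Suc (2 * l)) m n)) + w =
    tpow (2 * int l) * ((hf + hi) * ((hf + hi) * jones (pretzel_columns (Suc 0) m n)) + w)"
proof (induction l)
  case 0
  show ?case by (simp add: tpow_0)
next
  case (Suc l)
  let ?z = "hf + hi"
  let ?J = "\<lambda>l. jones (pretzel_columns (Suc (2 * l)) m n)"
  obtain d where "?J (Suc l) = tpow 2 * ?J l - tpow 1 * ((hi - hf) * jones (torus d (m + n)))"
    using jones_pretzel_left[of "Suc (2 * l)" m n] assms by auto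
  then have "?z * (?z * ?J (Suc l)) + w =
      tpow 2 * (?z * (?z * ?J l)) - tpow 1 * (((hi - hf) * ?z) * (?z * jones (torus d (m + n)))) + w"
    by (simp only: right_diff_distrib mult.assoc mult.left_commute)
  also have "\<dots> = tpow 2 * (?z * (?z * ?J l) + w)"
    unfolding circle_skein w
    by (simp only: distrib_left left_diff_distrib right_diff_distrib tpow_mult_assoc) (simp add: tpow_0)
  finally show ?case
    unfolding Suc tpow_mult_assoc by (simp add: algebra_simps)
qed

section \<open>Alternating sums of symmetric Laurent polynomials\<close>

definition tsym :: "int \<Rightarrow> laurent" where
  "tsym n = tpow n + tpow (- n)"

lemma square_tsym:
  "(tpow 1 + 2 + tpow (- 1)) * tsym n = tsym (n + 1) + 2 * tsym n + tsym (n - 1)"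
  by (simp add: tsym_def distrib_left distrib_right tpow_mult add.commute)

text \<open>Multiplication by z^2 spreads each term with coefficients 1, 2, 1. Against alternating
  signs the interior cancels and only boundary terms survive.\<close>

lemma alternating_sum:
  "(tpow 1 + 2 + tpow (- 1)) * (\<Sum>j = 1..2 * s. (- 1) ^ (j + 1) * tsym (int j)) =
    tpow 1 + 2 + tpow (- 1) - tsym (2 * int s) - tsym (2 * int s + 1)"
proof (induction s)
  case 0
  show ?case by (simp add: tsym_def tpow_0)
next
  case (Suc s)
  let ?q = "tpow 1 + 2 + tpow (- 1)"
  have "(\<Sum>j = 1..2 * Suc s. (- 1) ^ (j + 1) * tsym (int j)) =
     (\<Sum>j = 1..2 * s. (- 1) ^ (j + 1) * tsym (int j)) + tsym (2 * int s + 1) - tsym (2 * int s + 2)"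
    by (simp add: add.commute)
  then have "?q * (\<Sum>j = 1..2 * Suc s. (- 1) ^ (j + 1) * tsym (int j)) =
     ?q * (\<Sum>j = 1..2 * s. (- 1) ^ (j + 1) * tsym (int j)) +
     ?q * tsym (2 * int s + 1) - ?q * tsym (2 * int s + 2)"
    by (simp only: distrib_left[of ?q] right_diff_distrib[of ?q])
  then show ?case
    unfolding Suc square_tsym by (simp add: algebra_simps)
qed

text \<open>Coefficients linear in \<open>j\<close> still cancel in the interior. In the induction
  step every old weight grows by 2, which adds twice the unweighted sum.\<close>

lemma weighted_alternating_sum:
  "(tpow 1 + 2 + tpow (- 1)) *
     (\<Sum>j = 1..2 * s. (- 1) ^ (j + 1) * of_nat (2 * s + 1 - j) * tsym (int j)) =
    tsym 1 - tsym (2 * int s + 1) + 2 * of_nat s * (tpow 1 + 2 + tpow (- 1))"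
proof (induction s)
  case 0
  show ?case by simp
next
  case (Suc s)
  let ?c = "\<lambda>j. (- 1) ^ (j + 1) * tsym (int j)"
  \<comment> \<open>The two new terms carry the weights 2 and 1 with signs plus and minus.\<close>
  have "(\<Sum>j = 1..2 * Suc s. (- 1) ^ (j + 1) * of_nat (2 * Suc s + 1 - j) * tsym (int j)) =
     (\<Sum>j = 1..2 * s. (- 1) ^ (j + 1) * of_nat (2 * Suc s + 1 - j) * tsym (int j)) +
     2 * tsym (2 * int s + 1) - tsym (2 * int s + 2)"
    by (simp add: add.commute)
  also have "(\<Sum>j = 1..2 * s. (- 1) ^ (j + 1) * of_nat (2 * Suc s + 1 - j) * tsym (int j)) =
     (\<Sum>j = 1..2 * s. (- 1) ^ (j + 1) * of_nat (2 * s + 1 - j) * tsym (int j) + 2 * ?c j)"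
  proof (rule sum.cong)
    fix j assume "j \<in> {1..2 * s}"
    then have "j \<le> 2 * s" by simp
    \<comment> \<open>The weights use truncated subtraction, so the bound on \<open>j\<close> is
      essential here.\<close>
    then have "2 * Suc s + 1 - j = (2 * s + 1 - j) + 2" by arith
    then have "of_nat (2 * Suc s + 1 - j) = of_nat (2 * s + 1 - j) + (2 :: laurent)"
      by (metis of_nat_add of_nat_numeral)
    then show "(- 1) ^ (j + 1) * of_nat (2 * Suc s + 1 - j) * tsym (int j) =
        (- 1) ^ (j + 1) * of_nat (2 * s + 1 - j) * tsym (int j) + 2 * ?c j"
      by (simp only:) (simp add: algebra_simps)
  qed simp
  also have "\<dots> = (\<Sum>j = 1..2 * s. (- 1) ^ (j + 1) * of_nat (2 * s + 1 - j) * tsym (int j)) +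
      2 * (\<Sum>j = 1..2 * s. ?c j)"
    by (simp only: sum.distrib sum_distrib_left)
  finally have eq: "(\<Sum>j = 1..2 * Suc s. (- 1) ^ (j + 1) * of_nat (2 * Suc s + 1 - j) * tsym (int j)) =
     (\<Sum>j = 1..2 * s. (- 1) ^ (j + 1) * of_nat (2 * s + 1 - j) * tsym (int j)) +
      2 * (\<Sum>j = 1..2 * s. ?c j) + 2 * tsym (2 * int s + 1) - tsym (2 * int s + 2)" .
  let ?q = "tpow 1 + 2 + tpow (- 1)"
  have "?q * (\<Sum>j = 1..2 * Suc s. (- 1) ^ (j + 1) * of_nat (2 * Suc s + 1 - j) * tsym (int j)) =
     ?q * (\<Sum>j = 1..2 * s. (- 1) ^ (j + 1) * of_nat (2 * s + 1 - j) * tsym (int j)) +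
      2 * (?q * (\<Sum>j = 1..2 * s. ?c j)) + 2 * (?q * tsym (2 * int s + 1)) - ?q * tsym (2 * int s + 2)"
    unfolding eq distrib_left right_diff_distrib by (simp only: mult.left_commute)
  also have "\<dots> = tsym 1 - tsym (2 * int (Suc s) + 1) + 2 * of_nat (Suc s) * ?q"
    unfolding Suc alternating_sum square_tsym by (simp add: algebra_simps)
  finally show ?case .
qed

theorem theorem4p2:
  fixes s i :: nat
  assumes "s \<ge> 1" and "i \<ge> 1" and "real i > real s + 3 / 2"
  shows "jones (pretzel (- (2 * int s + 1)) (2 * int s + 1) (2 * int i + 1)) =
    1 + tpow (- 2 * int i - 1) *
      (tpow (2 * int s + 1) + tpow (- (2 * int s + 1)) - (tpow 1 + tpow (- 1)) - 2 * of_nat s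
       + (\<Sum>j = 1..2 * s. (- 1) ^ (j + 1) * of_nat (2 * s + 1 - j) * (tpow (int j) + tpow (- int j))))"
proof -
  let ?z = "hf + hi" and ?q = "tpow 1 + 2 + tpow (- 1)" and ?r = "tpow 1 + 1 + tpow (- 1)"
  let ?J = "jones (pretzel_columns (Suc (2 * s)) (Suc (2 * s)) (Suc (2 * i)))"
  let ?S = "\<Sum>j = 1..2 * s. (- 1) ^ (j + 1) * of_nat (2 * s + 1 - j) * tsym (int j)"
  \<comment> \<open>\<open>w\<close> and \<open>u\<close> are z times the values of the torus links
    met when smoothing the left and the middle column, with \<open>2 * (s + i + 1)\<close> and
    \<open>2 * i\<close> half-twists.\<close>
  define w where "w = - 1 - tpow (- 2 * int (s + i + 1)) * ?r"
  define u where "u = - 1 - tpow (- 2 * int i) * ?r"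
  have w: "?z * jones (torus d (Suc (2 * s) + Suc (2 * i))) = w" for d
  proof -
    have "Suc (2 * s) + Suc (2 * i) = 2 * (s + i + 1)" by simp
    then show ?thesis unfolding w_def by (simp only: jones_torus)
  qed
  have u: "?z * jones (torus False (2 * i)) = u"
    unfolding u_def by (rule jones_torus)
  have "?z * (?z * jones (pretzel_columns (Suc 0) (Suc (2 * s)) (Suc (2 * i)))) + u = tpow (- 2 * int s) * (?q + u)"
    using jones_pretzel_1[of "2 * i" s] unfolding u circle_square by simp
  then have 1: "?z * (?z * jones (pretzel_columns (Suc 0) (Suc (2 * s)) (Suc (2 * i)))) = tpow (- 2 * int s) * (?q + u) - u"
    by (simp add: eq_diff_eq)
  have "?z * (?z * ?J) + w = tpow (2 * int s) * (tpow (- 2 * int s) * (?q + u) - u + w)"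
    using jones_pretzel[of "Suc (2 * s)" "Suc (2 * i)" w s] w unfolding 1 by simp
  then have "?z * (?z * ?J) = tpow (2 * int s) * (tpow (- 2 * int s) * (?q + u) - u + w) - w"
    by (simp add: eq_diff_eq)
  \<comment> \<open>The left side is q + (1 - t^(2s)) (u - w), and u - w = t^(-2i-1) (t^(-2s-1) - t)
    r. Expanding (1 - t^(2s)) (t^(-2s-1) - t) gives the difference of the two \<open>tsym\<close>
    terms.\<close>
  also have "\<dots> = ?q + tpow (- 2 * int i - 1) * ((tsym (2 * int s + 1) - tsym 1) * ?r)"
    unfolding u_def w_def tsym_def
    by (simp add: tpow_mult tpow_0 algebra_simps) (simp add: minus_diff_commute diff_diff_eq, simp add: add.commute diff_diff_eq[symmetric] minus_diff_commute)
  also have "\<dots> = ?q * (1 + tpow (- 2 * int i - 1) * (tsym (2 * int s + 1) - tsym 1 - 2 * of_nat s + ?S))"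
  proof -
    have "?q * (tsym (2 * int s + 1) - tsym 1 - 2 * of_nat s + ?S) =
        ?q * (tsym (2 * int s + 1) - tsym 1) - 2 * of_nat s * ?q + ?q * ?S"
      by (simp only: distrib_left[of ?q] right_diff_distrib[of ?q] mult.commute[of ?q "2 * of_nat s"])
    \<comment> \<open>The multiples of \<open>of_nat s\<close> cancel, and q - 1 = r absorbs the
      boundary terms of the sum.\<close>
    also have "\<dots> = (tsym (2 * int s + 1) - tsym 1) * ?r"
      unfolding weighted_alternating_sum by (simp add: algebra_simps)
    finally show ?thesis
      unfolding distrib_left[of ?q 1] mult.left_commute[of ?q] by simp
  qed
  finally have "(?z * ?z) * ?J = (?z * ?z) * (1 + tpow (- 2 * int i - 1) * (tsym (2 * int s + 1) - tsym 1 - 2 * of_nat s + ?S))"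
    unfolding circle_square[symmetric] by (simp only: mult.assoc)
  \<comment> \<open>The Laurent ring has no zero divisors, so the nonzero factor z^2
    cancels.\<close>
  then have "?J = 1 + tpow (- 2 * int i - 1) * (tsym (2 * int s + 1) - tsym 1 - 2 * of_nat s + ?S)"
    using loop_value_nonzero by (simp only: mult_cancel_left mult_eq_0_iff) blast
  then show ?thesis
    unfolding pretzel_eq_columns tsym_def by simp
qed

end
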